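(* Let $m\ge1$, $\vec t=(t_1,\dots,t_m)$ with $t_1<\cdots<t_m$ real, and $\omega_0,\dots,\omega_m$ real with $\sum_{k=0}^\ell\omega_k\ge0$ for $\ell=0,\dots,m$, such that $w(x;\vec t)={\rm e}^{-x^2}\big(\omega_0+\sum_{k=1}^m\omega_k\theta(x-t_k)\big)$ is not identically zero. For $n\ge1$ let $D_n(\vec t)=\det\big(\int_{\mathbb{R}}x^{i+j}w(x;\vec t)dx\big)_{i,j=0}^{n-1}$ and $\sigma_n(\vec t)=\sum_{k=1}^m\frac{\partial}{\partial t_k}\ln D_n(\vec t)$. Then $\sigma_n$ satisfies the second order PDE $$\sum_{k=1}^m{\rm sgn}(\omega_k)\sqrt{\Delta_k(\vec t)}=2\Big(\sum_{k=1}^mt_k\frac{\partial\sigma_n}{\partial t_k}-\sigma_n\Big),$$ where ${\rm sgn}(\omega_k)$ is the sign of $\omega_k$ ($-1$, $0$ or $1$), $\sqrt{\cdot}$ is the nonnegative square root, $\mathcal L=\sum_{k=1}^m\partial/\partial t_k$, and $$\Delta_k(\vec t):=\Big(\frac{\partial^2\sigma_n}{\partial t_k^2}+\sum_{j\ne k}\frac{\partial^2\sigma_n}{\partial t_k\partial t_j}\Big)^2+4(\mathcal L\sigma_n+2n)\Big(\frac{\partial\sigma_n}{\partial t_k}\Big)^2.$$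
   Context: $\theta(y)=1$ for $y>0$ and $\theta(y)=0$ otherwise. *)

theory Defs
  imports "HOL-Analysis.Analysis"
begin

definition theta :: "real \<Rightarrow> real" where
  "theta y = (if y > 0 then 1 else 0)"

definition wgt :: "nat \<Rightarrow> (nat \<Rightarrow> real) \<Rightarrow> (nat \<Rightarrow> real) \<Rightarrow> real \<Rightarrow> real" where
  "wgt m \<omega> t x = exp (-(x^2)) * (\<omega> 0 + (\<Sum>k=1..m. \<omega> k * theta (x - t k)))"

definition moment :: "nat \<Rightarrow> (nat \<Rightarrow> real) \<Rightarrow> (nat \<Rightarrow> real) \<Rightarrow> nat \<Rightarrow> real" where
  "moment m \<omega> t i = integral\<^sup>L lborel (\<lambda>x. x ^ i * wgt m \<omega> t x)"

definition det_nat :: "nat \<Rightarrow> (nat \<Rightarrow> nat \<Rightarrow> real) \<Rightarrow> real" where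
  "det_nat n A = (\<Sum>p | p permutes {..<n}. of_int (sign p) * (\<Prod>i<n. A i (p i)))"

definition hankelD :: "nat \<Rightarrow> (nat \<Rightarrow> real) \<Rightarrow> nat \<Rightarrow> (nat \<Rightarrow> real) \<Rightarrow> real" where
  "hankelD m \<omega> n t = det_nat n (\<lambda>i j. moment m \<omega> t (i + j))"

definition partial_deriv :: "nat \<Rightarrow> ((nat \<Rightarrow> real) \<Rightarrow> real) \<Rightarrow> (nat \<Rightarrow> real) \<Rightarrow> real" where
  "partial_deriv k f t = deriv (\<lambda>s. f (t(k := s))) (t k)"

definition sigma :: "nat \<Rightarrow> (nat \<Rightarrow> real) \<Rightarrow> nat \<Rightarrow> (nat \<Rightarrow> real) \<Rightarrow> real" where
  "sigma m \<omega> n t = (\<Sum>k=1..m. partial_deriv k (\<lambda>s. ln (hankelD m \<omega> n s)) t)"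

end

(* Let P_j be the monic orthogonal polynomials of w, h_j their squared norms, alpha_j, beta_j the
   recurrence coefficients and c_k = omega_k exp(-t_k^2).  Only t-derivatives of the moments are
   needed: d/dt_k of the moment functional is -c_k times evaluation at t_k.  Since D_n is the product
   of the h_j, this gives d_k ln D_n = - sum_j c_k P_j(t_k)^2 / h_j, and integration by parts against
   exp(-x^2) turns the sum over k into sigma_n = 2 p_n, where p_n is the subleading coefficient of P_n.
   Differentiating the orthogonality relation of P_n and P_{n-1} yields d_k sigma_n = 2 r_k with
   r_k = c_k P_n(t_k) P_{n-1}(t_k) / h_{n-1}.  Shifting all jumps and the argument simultaneously acts
   on the P_n by a first-order ladder relation, hence
   L r_k = 2 c_k (beta_n P_{n-1}(t_k)^2 - P_n(t_k)^2) / h_{n-1}  and  L sigma_n + 2 n = 4 beta_n.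
   So Delta_k is the perfect square of 4 c_k (beta_n P_{n-1}(t_k)^2 + P_n(t_k)^2) / h_{n-1}, whose
   sign is that of omega_k, and both sides of the equation equal 8 beta_n (alpha_n + alpha_{n-1}). *)
theory Submission
  imports Defs "HOL-Probability.Distributions" "Jordan_Normal_Form.Determinant"
begin

section \<open>Orthogonal polynomials of a positive moment functional\<close>

hide_const (open) Module.smult

section \<open>The linear functional on polynomials with given moments\<close>

definition mlin :: "(nat \<Rightarrow> real) \<Rightarrow> real poly \<Rightarrow> real" where
  "mlin \<mu> p = (\<Sum>i\<le>degree p. coeff p i * \<mu> i)"

text \<open>Any degree bound may replace the degree, so several polynomials, or a polynomial
  depending on a parameter, can be summed over one fixed range.\<close>

lemma mlin_degree_le:
  assumes "degree p \<le> N"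
  shows "mlin \<mu> p = (\<Sum>i\<le>N. coeff p i * \<mu> i)"
  unfolding mlin_def using assms
  by (intro sum.mono_neutral_left) (auto intro: coeff_eq_0)

lemma mlin_0 [simp]: "mlin \<mu> 0 = 0"
  by (simp add: mlin_def)

lemma mlin_add: "mlin \<mu> (p + q) = mlin \<mu> p + mlin \<mu> q"
proof -
  define N where "N = max (degree p) (degree q)"
  have "degree p \<le> N" "degree q \<le> N" "degree (p + q) \<le> N"
    by (auto simp: N_def intro: degree_add_le)
  thus ?thesis by (simp add: mlin_degree_le[of _ N] sum.distrib algebra_simps)
qed

lemma mlin_smult: "mlin \<mu> (smult c p) = c * mlin \<mu> p"
  by (simp add: mlin_degree_le[of "smult c p" "degree p"] degree_smult_le mlin_def
      sum_distrib_left mult.assoc)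

lemma mlin_minus: "mlin \<mu> (- p) = - mlin \<mu> p"
  using mlin_smult[of \<mu> "-1" p] by simp

lemma mlin_diff: "mlin \<mu> (p - q) = mlin \<mu> p - mlin \<mu> q"
  using mlin_add[of \<mu> p "- q"] by (simp add: mlin_minus)

lemma mlin_pCons_0_add: "mlin \<mu> (pCons 0 (p + q)) = mlin \<mu> (pCons 0 p) + mlin \<mu> (pCons 0 q)"
  using mlin_add[of \<mu> "pCons 0 p" "pCons 0 q"] by simp

lemma mlin_pCons_0_diff: "mlin \<mu> (pCons 0 (p - q)) = mlin \<mu> (pCons 0 p) - mlin \<mu> (pCons 0 q)"
  using mlin_diff[of \<mu> "pCons 0 p" "pCons 0 q"] by simp

lemma mlin_sum: "mlin \<mu> (\<Sum>i\<in>A. f i) = (\<Sum>i\<in>A. mlin \<mu> (f i))"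
  by (induction A rule: infinite_finite_induct) (auto simp: mlin_add)

lemma mlin_monom: "mlin \<mu> (monom c n) = c * \<mu> n"
proof -
  have "mlin \<mu> (monom c n) = (\<Sum>i\<le>n. coeff (monom c n) i * \<mu> i)"
    by (rule mlin_degree_le) (rule degree_monom_le)
  also have "\<dots> = (\<Sum>i\<le>n. if i = n then c * \<mu> i else 0)"
    by (intro sum.cong) (auto simp: coeff_monom)
  finally show ?thesis by simp
qed

section \<open>Monic orthogonal polynomials by Gram-Schmidt\<close>

fun orthp :: "(nat \<Rightarrow> real) \<Rightarrow> nat \<Rightarrow> real poly" where
  "orthp \<mu> n = monom 1 n - (\<Sum>j<n. smult (mlin \<mu> (monom 1 n * orthp \<mu> j)
      / mlin \<mu> (orthp \<mu> j * orthp \<mu> j)) (orthp \<mu> j))"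

declare orthp.simps [simp del]

text \<open>Only the shape of the recursion matters, whatever the quotients are (division by zero
  gives 0). So the degree is known for every moment sequence, also where positivity fails.\<close>

lemma coeff_orthp: "(\<forall>i>n. coeff (orthp \<mu> n) i = 0) \<and> coeff (orthp \<mu> n) n = 1"
proof (induction n rule: less_induct)
  case (less n)
  have "coeff (orthp \<mu> n) i = (if i = n then 1 else 0)" if "i \<ge> n" for i
  proof -
    have "coeff (orthp \<mu> j) i = 0" if "j < n" for j
      using less[OF that] that \<open>i \<ge> n\<close> by auto
    thus ?thesis
      by (subst orthp.simps) (auto simp: coeff_sum)
  qed
  thus ?case by auto
qed

lemma coeff_orthp_eq_0: "i > n \<Longrightarrow> coeff (orthp \<mu> n) i = 0"
  and coeff_orthp_self [simp]: "coeff (orthp \<mu> n) n = 1"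
  using coeff_orthp by auto

lemma degree_orthp [simp]: "degree (orthp \<mu> n) = n"
  by (intro antisym degree_le le_degree) (auto simp: coeff_orthp_eq_0)

lemma orthp_nonzero [simp]: "orthp \<mu> n \<noteq> 0"
  using coeff_orthp_self[of \<mu> n] by fastforce

definition onorm2 :: "(nat \<Rightarrow> real) \<Rightarrow> nat \<Rightarrow> real" where
  "onorm2 \<mu> n = mlin \<mu> (orthp \<mu> n * orthp \<mu> n)"

abbreviation (input) mulx :: "real poly \<Rightarrow> real poly" where
  "mulx p \<equiv> pCons 0 p"

text \<open>The coefficient of degree \<open>n - 1\<close>; multiplying by the variable first makes it 0 for \<open>n = 0\<close>.\<close>
definition subl :: "(nat \<Rightarrow> real) \<Rightarrow> nat \<Rightarrow> real" where
  "subl \<mu> n = coeff (mulx (orthp \<mu> n)) n"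

text \<open>The diagonal coefficient of the three-term recurrence, written through subleading
  coefficients so that it telescopes; \<open>mlin_mulx_orthp_sq\<close> recovers the usual
  quotient.\<close>

definition alph :: "(nat \<Rightarrow> real) \<Rightarrow> nat \<Rightarrow> real" where
  "alph \<mu> n = subl \<mu> n - subl \<mu> (Suc n)"

lemma subl_0 [simp]: "subl \<mu> 0 = 0"
  by (simp add: subl_def)

lemma subl_Suc: "subl \<mu> (Suc n) = coeff (orthp \<mu> (Suc n)) n"
  by (simp add: subl_def)

definition pos_moments :: "(nat \<Rightarrow> real) \<Rightarrow> bool" where
  "pos_moments \<mu> \<longleftrightarrow> (\<forall>p. p \<noteq> 0 \<longrightarrow> mlin \<mu> (p * p) > 0)"

locale pos_moment_functional =
  fixes \<mu> :: "nat \<Rightarrow> real"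
  assumes pos: "pos_moments \<mu>"
begin

abbreviation "L \<equiv> mlin \<mu>"
abbreviation "P \<equiv> orthp \<mu>"
abbreviation "h \<equiv> onorm2 \<mu>"
abbreviation "\<alpha> \<equiv> alph \<mu>"

lemma onorm2_pos: "h n > 0"
  using pos by (simp add: pos_moments_def onorm2_def)

lemma onorm2_nonzero [simp]: "h n \<noteq> 0"
  using onorm2_pos[of n] by simp

lemma orthp_orthogonal: "j < n \<Longrightarrow> L (P n * P j) = 0"
proof (induction n arbitrary: j rule: less_induct)
  case (less n)
  let ?c = "\<lambda>i. L (monom 1 n * P i) / L (P i * P i)"
  have IH: "L (P i * P j) = 0" if "i < n" "i \<noteq> j" for i
  proof (cases "i < j")
    case True
    thus ?thesis using less.IH[of j i] less.prems by (simp add: mult.commute)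
  next
    case False
    thus ?thesis using less.IH[of i j] that by simp
  qed
  have "L (P n * P j) = L (monom 1 n * P j) - (\<Sum>i<n. ?c i * L (P i * P j))"
    by (subst orthp.simps)
      (simp add: algebra_simps mlin_diff sum_distrib_right sum_distrib_left mlin_sum mlin_smult)
  also have "(\<Sum>i<n. ?c i * L (P i * P j)) = (\<Sum>i<n. if i = j then L (monom 1 n * P j) else 0)"
  proof (intro sum.cong refl)
    fix i assume "i \<in> {..<n}"
    thus "?c i * L (P i * P j) = (if i = j then L (monom 1 n * P j) else 0)"
      using IH[of i] onorm2_nonzero[of j] by (auto simp: onorm2_def)
  qed
  finally show ?case using less.prems by simp
qed

text \<open>Subtracting a multiple of \<open>P m\<close> removes the top coefficient of
  \<open>q\<close>, so induction on the bound applies. The hypothesis is on coefficients because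
  "degree below n" must mean \<open>q = 0\<close> when \<open>n = 0\<close>.\<close>

lemma orthp_orthogonal_lower:
  assumes "\<And>i. i \<ge> n \<Longrightarrow> coeff q i = 0"
  shows "L (q * P n) = 0"
proof -
  have "L (q * P n) = 0" if "m \<le> n" "\<And>i. i \<ge> m \<Longrightarrow> coeff q i = 0" for m q
    using that
  proof (induction m arbitrary: q)
    case 0
    hence "q = 0" by (intro poly_eqI) simp
    thus ?case by simp
  next
    case (Suc m)
    let ?q = "q - smult (coeff q m) (P m)"
    have "coeff ?q i = 0" if "i \<ge> m" for i
      using Suc.prems(2)[of i] that coeff_orthp_eq_0[of m i] by (cases "i = m") auto
    from Suc.IH[OF _ this] Suc.prems have "L (?q * P n) = 0" by simp
    moreover have "L (P m * P n) = 0"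
      using orthp_orthogonal[of m n] Suc.prems by (simp add: mult.commute)
    ultimately show ?case
      by (simp add: algebra_simps mlin_diff mlin_smult)
  qed
  from this[of n q] assms show ?thesis by simp
qed

text \<open>Removing the multiple of \<open>P n\<close> with the same coefficient of degree
  \<open>n\<close> leaves something orthogonal to \<open>P n\<close>. Most values of
  \<open>L\<close> below are found this way.\<close>

lemma mlin_times_orthp:
  assumes "\<And>i. i > n \<Longrightarrow> coeff q i = 0"
  shows "L (q * P n) = coeff q n * h n"
proof -
  let ?q = "q - smult (coeff q n) (P n)"
  have "coeff ?q i = 0" if "i \<ge> n" for i
    using assms[of i] that coeff_orthp_eq_0[of n i] by (cases "i = n") auto
  from orthp_orthogonal_lower[OF this] have "L (?q * P n) = 0" .
  thus ?thesis by (simp add: algebra_simps mlin_diff mlin_smult onorm2_def)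
qed

text \<open>A nonzero difference of degree \<open>d\<close> pairs with \<open>P d\<close> to its
  leading coefficient times \<open>h d\<close>, which is not zero.\<close>

lemma poly_eq_if_tested_orthp:
  assumes "degree S \<le> n" "degree T \<le> n"
    and eq: "\<And>i. i \<le> n \<Longrightarrow> L (S * P i) = L (T * P i)"
  shows "S = T"
proof (rule ccontr)
  assume "S \<noteq> T"
  define D where "D = S - T"
  have D: "D \<noteq> 0" "degree D \<le> n"
    using \<open>S \<noteq> T\<close> assms by (auto simp: D_def intro: degree_diff_le)
  have "L (D * P (degree D)) = 0"
    using eq[of "degree D"] D by (simp add: D_def algebra_simps mlin_diff)
  moreover have "L (D * P (degree D)) = coeff D (degree D) * h (degree D)"
    by (rule mlin_times_orthp) (simp add: coeff_eq_0)
  ultimately show False using D by simp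
qed

lemma mlin_mulx_orthp_sq: "L (mulx (P n * P n)) = \<alpha> n * h n"
proof -
  let ?q = "mulx (P n) - P (Suc n)"
  have "coeff ?q i = 0" if "i > n" for i
    using that by (cases "i = Suc n") (auto simp: coeff_pCons coeff_orthp_eq_0 split: nat.splits)
  hence "L (?q * P n) = coeff ?q n * h n"
    by (intro mlin_times_orthp) auto
  moreover have "coeff ?q n = \<alpha> n"
    by (simp add: alph_def subl_def)
  ultimately show ?thesis
    using orthp_orthogonal[of n "Suc n"] by (simp add: algebra_simps mlin_diff)
qed

lemma subl_eq_sum_alph: "subl \<mu> n = - (\<Sum>j<n. \<alpha> j)"
  by (induction n) (auto simp: alph_def)

lemma mlin_mulx_consecutive: "L (mulx (P (Suc n) * P n)) = h (Suc n)"
proof -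
  have "L (mulx (P n) * P (Suc n)) = coeff (mulx (P n)) (Suc n) * h (Suc n)"
    by (rule mlin_times_orthp) (auto simp: coeff_pCons coeff_orthp_eq_0 split: nat.splits)
  thus ?thesis by (simp add: mult.commute)
qed

text \<open>Both sides have degree at most \<open>Suc n\<close> and are tested against
  \<open>P i\<close>. Moving the variable onto \<open>P i\<close> kills all \<open>i < n\<close>,
  the choice of \<open>\<alpha>\<close> kills \<open>i = Suc n\<close>, and \<open>i = n\<close>
  gives the off-diagonal coefficient \<open>h (Suc n) / h n\<close>.\<close>

lemma three_term:
  "mulx (P (Suc n)) - smult (\<alpha> (Suc n)) (P (Suc n)) - P (Suc (Suc n))
     = smult (h (Suc n) / h n) (P n)" (is "?A = _")
proof (rule poly_eq_if_tested_orthp[of _ "Suc n"])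
  show "degree ?A \<le> Suc n"
  proof (rule degree_le, safe)
    fix i assume "Suc n < i"
    thus "coeff ?A i = 0"
      by (cases "i = Suc (Suc n)")
         (auto simp: coeff_orthp_eq_0 coeff_pCons split: nat.splits)
  qed
  show "degree (smult (h (Suc n) / h n) (P n)) \<le> Suc n" by simp
  fix i assume i: "i \<le> Suc n"
  have A: "L (?A * P i) = L (mulx (P i) * P (Suc n)) - \<alpha> (Suc n) * L (P (Suc n) * P i)"
    using orthp_orthogonal[of i "Suc (Suc n)"] i
    by (simp add: algebra_simps mlin_add mlin_diff mlin_smult)
  have R: "L (smult c (P n) * P i) = c * L (P n * P i)" for c
    by (simp add: mlin_smult)
  consider "i = Suc n" | "i = n" | "i < n" using i by linarith
  thus "L (?A * P i) = L (smult (h (Suc n) / h n) (P n) * P i)"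
  proof cases
    case 1
    have "L (P n * P (Suc n)) = 0"
      using orthp_orthogonal[of n "Suc n"] by (simp add: mult.commute)
    thus ?thesis unfolding A R using 1 mlin_mulx_orthp_sq[of "Suc n"] by (simp add: onorm2_def)
  next
    case 2
    have "L (mulx (P n) * P (Suc n)) = h (Suc n)"
      using mlin_mulx_consecutive[of n] by (simp add: mult.commute)
    thus ?thesis unfolding A R using 2 orthp_orthogonal[of n "Suc n"]
      by (simp add: onorm2_def[symmetric])
  next
    case 3
    have "L (mulx (P i) * P (Suc n)) = 0"
      using 3 by (intro orthp_orthogonal_lower) (auto simp: coeff_pCons coeff_orthp_eq_0 split: nat.splits)
    thus ?thesis unfolding A R using 3 orthp_orthogonal[of i "Suc n"] orthp_orthogonal[of i n] by simp
  qed
qed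

text \<open>The square of the variable times \<open>P n\<close> agrees with the variable times
  \<open>P (Suc n)\<close> in the top degree; their difference has coefficient
  \<open>\<alpha> n\<close> in degree \<open>Suc n\<close>.\<close>

lemma mlin_mulx2: "L (mulx (mulx (P (Suc n) * P n))) = (\<alpha> (Suc n) + \<alpha> n) * h (Suc n)"
proof -
  let ?q = "mulx (mulx (P n)) - mulx (P (Suc n))"
  have "coeff ?q i = 0" if "i > Suc n" for i
    using that by (cases "i = Suc (Suc n)")
      (auto simp: coeff_pCons coeff_orthp_eq_0 less_Suc_eq split: nat.splits)
  hence "L (?q * P (Suc n)) = coeff ?q (Suc n) * h (Suc n)"
    by (intro mlin_times_orthp) auto
  moreover have "coeff ?q (Suc n) = \<alpha> n"
    by (simp add: alph_def subl_def)
  ultimately show ?thesis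
    using mlin_mulx_orthp_sq[of "Suc n"]
    by (simp add: algebra_simps mlin_diff mlin_pCons_0_diff)
qed

lemma mlin_pderiv_self: "L (pderiv (P n * P n)) = 0"
proof -
  have "L (pderiv (P n) * P n) = 0"
    by (rule orthp_orthogonal_lower) (simp add: coeff_pderiv coeff_orthp_eq_0)
  thus ?thesis unfolding pderiv_mult mlin_add by (simp add: mult.commute)
qed

lemma mlin_pderiv_prod: "L (pderiv (P (Suc n) * P n)) = real (Suc n) * h n"
proof -
  have "L (pderiv (P n) * P (Suc n)) = 0"
    by (rule orthp_orthogonal_lower) (simp add: coeff_pderiv coeff_orthp_eq_0)
  moreover have "L (pderiv (P (Suc n)) * P n) = coeff (pderiv (P (Suc n))) n * h n"
    by (rule mlin_times_orthp) (simp add: coeff_pderiv coeff_orthp_eq_0)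
  ultimately show ?thesis by (simp add: pderiv_mult mlin_add mult.commute coeff_pderiv)
qed

text \<open>The Euler operator multiplies the i-th coefficient by i. Subtracting
  \<open>Suc n\<close> times \<open>P (Suc n)\<close> therefore cancels the leading term and leaves
  minus the subleading coefficient on top.\<close>

lemma mlin_pderiv_mulx_prod: "L (pderiv (mulx (P (Suc n) * P n))) = - subl \<mu> (Suc n) * h n"
proof -
  let ?q = "mulx (pderiv (P (Suc n))) - smult (real (Suc n)) (P (Suc n))"
  have "coeff ?q i = 0" if "i > n" for i
    using that coeff_orthp_eq_0[of "Suc n" i \<mu>]
    by (cases "i = Suc n") (auto simp: coeff_pCons coeff_pderiv split: nat.splits)
  hence "L (?q * P n) = coeff ?q n * h n"
    by (intro mlin_times_orthp) auto
  moreover have "coeff ?q n = - subl \<mu> (Suc n)"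
    by (cases n) (auto simp: subl_Suc coeff_pCons coeff_pderiv algebra_simps)
  moreover have "L (mulx (pderiv (P n)) * P (Suc n)) = 0"
    by (rule orthp_orthogonal_lower)
      (auto simp: coeff_pCons coeff_pderiv coeff_orthp_eq_0 split: nat.splits)
  moreover have "L (P (Suc n) * P n) = 0"
    using orthp_orthogonal[of n "Suc n"] by simp
  moreover have "L (?q * P n) = L (mulx (pderiv (P (Suc n))) * P n) - real (Suc n) * L (P (Suc n) * P n)"
    by (simp only: left_diff_distrib mlin_diff mult_smult_left mlin_smult)
  moreover have "pderiv (mulx (P (Suc n) * P n)) = P (Suc n) * P n
      + (mulx (pderiv (P (Suc n))) * P n + mulx (pderiv (P n)) * P (Suc n))"
    by (simp add: pderiv_pCons pderiv_mult algebra_simps)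
  ultimately show ?thesis by (simp add: mlin_add mlin_pCons_0_add)
qed

end

section \<open>The Hankel determinant as a product of squared norms\<close>

lemma det_nat_eq_prod_onorm2:
  assumes "pos_moments \<mu>"
  shows "det_nat n (\<lambda>i j. \<mu> (i + j)) = (\<Prod>j<n. onorm2 \<mu> j)"
proof -
  interpret pos_moment_functional \<mu> by standard fact
  \<comment> \<open>\<open>C\<close> passes from monomials to orthogonal polynomials. It is
    unitriangular, so it preserves the determinant while making the Gram matrix \<open>G\<close>
    diagonal.\<close>
  define G where "G = Matrix.mat n n (\<lambda>(i, j). \<mu> (i + j))"
  define C where "C = Matrix.mat n n (\<lambda>(i, j). coeff (P i) j)"
  have G: "G \<in> carrier_mat n n" and C: "C \<in> carrier_mat n n"
    by (auto simp: G_def C_def)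
  have exp: "P i = (\<Sum>k<n. monom (coeff (P i) k) k)" if "i < n" for i
    using that by (intro poly_eqI) (auto simp: coeff_sum coeff_orthp_eq_0 not_less)
  have ent: "(C * G * transpose_mat C) $$ (i, j) = L (P i * P j)" if "i < n" "j < n" for i j
  proof -
    have "L (P i * P j) = L ((\<Sum>k<n. monom (coeff (P i) k) k) * (\<Sum>l<n. monom (coeff (P j) l) l))"
      using exp that by metis
    also have "\<dots> = (\<Sum>k<n. \<Sum>l<n. coeff (P i) k * coeff (P j) l * \<mu> (k + l))"
      by (simp add: sum_product mlin_sum mult_monom mlin_monom)
    also have "\<dots> = (\<Sum>l<n. \<Sum>k<n. coeff (P i) k * coeff (P j) l * \<mu> (k + l))"
      by (rule sum.swap)
    also have "\<dots> = (C * G * transpose_mat C) $$ (i, j)"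
      using that by (simp add: C_def G_def scalar_prod_def lessThan_atLeast0 sum_distrib_right
          sum_distrib_left mult_ac)
    finally show ?thesis ..
  qed
  define D where "D = Matrix.mat n n (\<lambda>(i, j). L (P i * P j))"
  have D: "C * G * transpose_mat C = D"
    by (rule eq_matI) (use ent G C in \<open>auto simp: D_def\<close>)
  have "Determinant.det C = prod_list (diag_mat C)"
    by (rule Determinant.det_lower_triangular[of n]) (auto simp: C_def coeff_orthp_eq_0)
  hence dC: "Determinant.det C = 1"
    by (simp add: prod_list_diag_prod C_def)
  have "L (P i * P j) = 0" if "i < j" for i j
    using orthp_orthogonal[OF that] by (simp add: mult.commute)
  note this [simp]
  have "Determinant.det D = prod_list (diag_mat D)"
    by (rule Determinant.det_lower_triangular[of n])
      (auto simp: D_def)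
  hence dD: "Determinant.det D = (\<Prod>j<n. h j)"
    by (simp add: prod_list_diag_prod D_def onorm2_def lessThan_atLeast0)
  have "Determinant.det D = Determinant.det C * Determinant.det G * Determinant.det C"
    unfolding D[symmetric] using G C
    by (simp add: Determinant.det_mult[of _ n] Determinant.det_transpose)
  moreover have "Determinant.det G = det_nat n (\<lambda>i j. \<mu> (i + j))"
    unfolding det_nat_def by (subst det_def'[OF G], intro sum.cong)
      (auto simp: G_def lessThan_atLeast0 permutes_in_image intro!: prod.cong)
  ultimately show ?thesis using dC dD by simp
qed

section \<open>The Gaussian weight with jumps\<close>

lemma integrable_power_gauss: "integrable lborel (\<lambda>x::real. x ^ i * exp (- x\<^sup>2))"
proof -
  \<comment> \<open>With standard deviation \<open>1 / sqrt 2\<close> the normal density is the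
    weight \<open>exp (- x\<^sup>2)\<close> up to the factor \<open>sqrt pi\<close>.\<close>
  have "normal_density 0 (1 / sqrt 2) x * (x - 0) ^ i = x ^ i * exp (- x\<^sup>2) / sqrt pi" for x :: real
    by (simp add: normal_density_def power_divide)
  with integrable_normal_moment[of "1 / sqrt 2" 0 i]
  have "integrable lborel (\<lambda>x::real. x ^ i * exp (- x\<^sup>2) / sqrt pi)" by simp
  from Bochner_Integration.integrable_mult_right[where c = "sqrt pi", OF this] show ?thesis by simp
qed

lemma integrable_poly_gauss: "integrable lborel (\<lambda>x::real. poly p x * exp (- x\<^sup>2))"
proof -
  have "(\<lambda>x::real. poly p x * exp (- x\<^sup>2)) = (\<lambda>x. \<Sum>i\<le>degree p. coeff p i * (x ^ i * exp (- x\<^sup>2)))"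
    by (auto simp: poly_altdef sum_distrib_right mult.assoc)
  thus ?thesis by (auto intro!: integrable_power_gauss)
qed

lemma set_integrable_poly_gauss:
  "A \<in> sets lborel \<Longrightarrow> set_integrable lborel A (\<lambda>x::real. poly p x * exp (- x\<^sup>2))"
  unfolding set_integrable_def by (rule integrable_mult_indicator[OF _ integrable_poly_gauss])

text \<open>The weight is a combination of the full Gaussian and its restrictions to half-lines, so
  each jump position enters exactly one term.\<close>

definition gauss_tail :: "real poly \<Rightarrow> real \<Rightarrow> real" where
  "gauss_tail p a = (LINT x:{a<..}|lborel. poly p x * exp (- x\<^sup>2))"

definition gauss_full :: "real poly \<Rightarrow> real" where
  "gauss_full p = integral\<^sup>L lborel (\<lambda>x. poly p x * exp (- x\<^sup>2))"

lemma wgt_times_poly: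
  "poly p x * wgt m \<omega> t x = \<omega> 0 * (poly p x * exp (- x\<^sup>2))
    + (\<Sum>k=1..m. \<omega> k * (indicator {t k<..} x *\<^sub>R (poly p x * exp (- x\<^sup>2))))"
proof -
  have "theta (x - t k) = indicator {t k<..} x" for k
    by (simp add: theta_def indicator_def)
  thus ?thesis
    by (simp only: wgt_def real_scaleR_def distrib_left sum_distrib_left mult_ac)
qed

lemma integrable_poly_wgt: "integrable lborel (\<lambda>x. poly p x * wgt m \<omega> t x)"
  unfolding wgt_times_poly
  by (intro Bochner_Integration.integrable_add Bochner_Integration.integrable_sum
      Bochner_Integration.integrable_mult_right integrable_poly_gauss
      set_integrable_poly_gauss[unfolded set_integrable_def]) auto

lemma integral_poly_wgt_split:
  "integral\<^sup>L lborel (\<lambda>x. poly p x * wgt m \<omega> t x)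
     = \<omega> 0 * gauss_full p + (\<Sum>k=1..m. \<omega> k * gauss_tail p (t k))"
proof -
  have i: "integrable lborel (\<lambda>x. indicator {t k<..} x *\<^sub>R (poly p x * exp (- x\<^sup>2)))" for k
    by (rule set_integrable_poly_gauss[unfolded set_integrable_def]) auto
  show ?thesis
    unfolding wgt_times_poly
    by (subst Bochner_Integration.integral_add)
      (simp_all only: integrable_poly_gauss i Bochner_Integration.integrable_sum integrable_mult_right
        Bochner_Integration.integral_sum integral_mult_right_zero gauss_full_def gauss_tail_def
        set_lebesgue_integral_def)
qed

lemma moment_eq_integral_monom:
  "moment m \<omega> t i = integral\<^sup>L lborel (\<lambda>x. poly (monom 1 i) x * wgt m \<omega> t x)"
  by (simp add: moment_def poly_monom)

lemma mlin_moment: "mlin (moment m \<omega> t) p = integral\<^sup>L lborel (\<lambda>x. poly p x * wgt m \<omega> t x)"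
proof -
  have "(\<lambda>x. poly p x * wgt m \<omega> t x)
      = (\<lambda>x. \<Sum>i\<le>degree p. coeff p i * (poly (monom 1 i) x * wgt m \<omega> t x))"
    by (auto simp: poly_altdef[of p] sum_distrib_right mult.assoc poly_monom)
  thus ?thesis
    using integrable_poly_wgt
    by (simp add: mlin_def moment_eq_integral_monom Bochner_Integration.integral_sum)
qed

section \<open>Integration by parts against the Gaussian\<close>

lemma gauss_poly_has_derivative:
  "((\<lambda>x. poly p x * exp (- x\<^sup>2)) has_real_derivative
     poly (pderiv p - smult 2 (pCons 0 p)) x * exp (- x\<^sup>2)) (at x)"
  by (auto intro!: derivative_eq_intros simp: algebra_simps power2_eq_square)

lemma power_gauss_at_top: "((\<lambda>x::real. x ^ i * exp (- x\<^sup>2)) \<longlongrightarrow> 0) at_top"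
proof (rule Lim_null_comparison)
  show "((\<lambda>x::real. x ^ i / exp x) \<longlongrightarrow> 0) at_top"
    by (rule tendsto_power_div_exp_0)
  show "\<forall>\<^sub>F x::real in at_top. norm (x ^ i * exp (- x\<^sup>2)) \<le> x ^ i / exp x"
    using eventually_ge_at_top[of 1]
  proof eventually_elim
    case (elim x)
    have "x \<le> x\<^sup>2" using elim self_le_power[of x 2] by simp
    hence "exp (- x\<^sup>2) \<le> exp (- x)" by simp
    hence "x ^ i * exp (- x\<^sup>2) \<le> x ^ i * exp (- x)"
      using elim by (intro mult_left_mono) auto
    thus ?case using elim by (simp add: exp_minus field_simps)
  qed
qed

lemma poly_gauss_at_top: "((\<lambda>x::real. poly p x * exp (- x\<^sup>2)) \<longlongrightarrow> 0) at_top"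
proof -
  have "((\<lambda>x. \<Sum>i\<le>degree p. coeff p i * (x ^ i * exp (- x\<^sup>2))) \<longlongrightarrow> (\<Sum>i\<le>degree p. coeff p i * 0)) at_top"
    by (intro tendsto_intros power_gauss_at_top)
  thus ?thesis by (simp add: poly_altdef sum_distrib_right mult.assoc)
qed

lemma poly_gauss_at_bot: "((\<lambda>x::real. poly p x * exp (- x\<^sup>2)) \<longlongrightarrow> 0) at_bot"
  using poly_gauss_at_top[of "pcompose p [:0, -1:]"]
  by (simp add: filterlim_at_bot_mirror poly_pcompose)

text \<open>The integrand is the derivative of \<open>p\<close> times the Gaussian, which vanishes
  at infinity, so only the boundary value at \<open>a\<close> remains.\<close>

lemma gauss_tail_ibp: "gauss_tail (pderiv p - smult 2 (pCons 0 p)) a = - (poly p a * exp (- a\<^sup>2))"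
proof -
  let ?F = "\<lambda>x. poly p x * exp (- x\<^sup>2)"
  let ?f = "\<lambda>x. poly (pderiv p - smult 2 (pCons 0 p)) x * exp (- x\<^sup>2)"
  have "(LBINT x=ereal a..\<infinity>. ?f x) = 0 - ?F a"
  proof (rule interval_integral_FTC_integrable)
    show "set_integrable lborel (einterval (ereal a) \<infinity>) ?f"
      by (rule set_integrable_poly_gauss) auto
    show "(?F has_vector_derivative ?f x) (at x)" for x
      using gauss_poly_has_derivative by (simp add: has_real_derivative_iff_has_vector_derivative)
    show "((?F \<circ> real_of_ereal) \<longlongrightarrow> ?F a) (at_right (ereal a))"
      unfolding ereal_tendsto_simps by (intro tendsto_intros) 
    show "((?F \<circ> real_of_ereal) \<longlongrightarrow> 0) (at_left \<infinity>)"
      unfolding ereal_tendsto_simps by (rule poly_gauss_at_top)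
  qed (auto intro!: continuous_intros)
  thus ?thesis unfolding interval_integral_to_infinity_eq gauss_tail_def by simp
qed

lemma gauss_full_ibp: "gauss_full (pderiv p - smult 2 (pCons 0 p)) = 0"
proof -
  let ?F = "\<lambda>x. poly p x * exp (- x\<^sup>2)"
  let ?f = "\<lambda>x. poly (pderiv p - smult 2 (pCons 0 p)) x * exp (- x\<^sup>2)"
  have "(LBINT x=-\<infinity>..\<infinity>. ?f x) = 0 - 0"
  proof (rule interval_integral_FTC_integrable)
    show "set_integrable lborel (einterval (-\<infinity>) \<infinity>) ?f"
      by (rule set_integrable_poly_gauss) auto
    show "(?F has_vector_derivative ?f x) (at x)" for x
      using gauss_poly_has_derivative by (simp add: has_real_derivative_iff_has_vector_derivative)
    show "((?F \<circ> real_of_ereal) \<longlongrightarrow> 0) (at_right (-\<infinity>))"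
      unfolding ereal_tendsto_simps by (rule poly_gauss_at_bot)
    show "((?F \<circ> real_of_ereal) \<longlongrightarrow> 0) (at_left \<infinity>)"
      unfolding ereal_tendsto_simps by (rule poly_gauss_at_top)
  qed (auto intro!: continuous_intros)
  thus ?thesis
    by (simp add: interval_lebesgue_integral_def einterval_def set_lebesgue_integral_def gauss_full_def)
qed

text \<open>Pearson equation of the weight: its distributional derivative is -2x times the weight
  plus a point mass at each jump.\<close>

lemma mlin_moment_ibp:
  "2 * mlin (moment m \<omega> t) (pCons 0 p) =
     mlin (moment m \<omega> t) (pderiv p) + (\<Sum>k=1..m. \<omega> k * exp (- (t k)\<^sup>2) * poly p (t k))"
proof -
  have "mlin (moment m \<omega> t) (pderiv p - smult 2 (pCons 0 p))
      = - (\<Sum>k=1..m. \<omega> k * exp (- (t k)\<^sup>2) * poly p (t k))"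
    unfolding mlin_moment integral_poly_wgt_split gauss_full_ibp gauss_tail_ibp
    by (simp add: sum_negf mult_ac)
  thus ?thesis by (simp add: mlin_diff mlin_smult del: smult_pCons)
qed

section \<open>Derivatives of the moments in the jump positions\<close>

lemma gauss_tail_has_derivative:
  "(gauss_tail p has_real_derivative - (poly p a * exp (- a\<^sup>2))) (at a)"
proof -
  let ?f = "\<lambda>x. poly p x * exp (- x\<^sup>2)"
  \<comment> \<open>The base point \<open>a - 1\<close> turns the tail into a constant minus an
    integral with variable upper end, differentiable at the interior point \<open>a\<close>.\<close>
  have eq: "gauss_tail p u = gauss_tail p (a - 1) - (LBINT x=ereal (a-1)..ereal u. ?f x)" for u
  proof -
    have "(LBINT x=ereal (a-1)..ereal u. ?f x) + (LBINT x=ereal u..\<infinity>. ?f x) = (LBINT x=ereal (a-1)..\<infinity>. ?f x)"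
      by (rule interval_integral_sum)
        (simp add: interval_lebesgue_integrable_def set_integrable_poly_gauss)
    thus ?thesis unfolding interval_integral_to_infinity_eq gauss_tail_def by simp
  qed
  have "((\<lambda>u. LBINT x=ereal (a-1)..ereal u. ?f x) has_vector_derivative ?f a) (at a within {a-1..a+1})"
    by (rule interval_integral_FTC2) (auto intro!: continuous_intros)
  hence "((\<lambda>u. LBINT x=ereal (a-1)..ereal u. ?f x) has_real_derivative ?f a) (at a)"
    by (simp add: has_real_derivative_iff_has_vector_derivative at_within_Icc_at)
  hence "((\<lambda>u. gauss_tail p (a - 1) - (LBINT x=ereal (a-1)..ereal u. ?f x)) has_real_derivative 0 - ?f a) (at a)"
    by (intro DERIV_diff DERIV_const)
  thus ?thesis unfolding eq[symmetric] by simp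
qed

lemma moment_has_derivative:
  assumes "k \<in> {1..m}"
  shows "((\<lambda>s. moment m \<omega> (t(k := s)) i) has_real_derivative - \<omega> k * exp (- (t k)\<^sup>2) * t k ^ i) (at (t k))"
proof -
  have "moment m \<omega> (t(k := s)) i = (\<omega> 0 * gauss_full (monom 1 i)
      + (\<Sum>j\<in>{1..m}-{k}. \<omega> j * gauss_tail (monom 1 i) (t j))) + \<omega> k * gauss_tail (monom 1 i) s" for s
  proof -
    have "(\<Sum>j=1..m. \<omega> j * gauss_tail (monom 1 i) ((t(k := s)) j))
      = \<omega> k * gauss_tail (monom 1 i) s + (\<Sum>j\<in>{1..m}-{k}. \<omega> j * gauss_tail (monom 1 i) ((t(k := s)) j))"
      using assms by (subst sum.remove[of _ k]) auto
    also have "(\<Sum>j\<in>{1..m}-{k}. \<omega> j * gauss_tail (monom 1 i) ((t(k := s)) j))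
       = (\<Sum>j\<in>{1..m}-{k}. \<omega> j * gauss_tail (monom 1 i) (t j))"
      by (intro sum.cong) auto
    finally show ?thesis unfolding moment_eq_integral_monom integral_poly_wgt_split by simp
  qed
  moreover have "((\<lambda>s. (\<omega> 0 * gauss_full (monom 1 i)
      + (\<Sum>j\<in>{1..m}-{k}. \<omega> j * gauss_tail (monom 1 i) (t j))) + \<omega> k * gauss_tail (monom 1 i) s)
      has_real_derivative 0 + \<omega> k * (- (poly (monom 1 i) (t k) * exp (- (t k)\<^sup>2)))) (at (t k))"
    by (intro DERIV_add DERIV_const DERIV_cmult gauss_tail_has_derivative)
  ultimately show ?thesis by (simp add: poly_monom mult_ac)
qed

text \<open>Identifies the functional whose moments are the derivatives of the moments in a jump
  position: a multiple of point evaluation.\<close>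

lemma mlin_powers: "mlin (\<lambda>i. c * x ^ i) p = c * poly p x"
  by (simp add: mlin_def poly_altdef sum_distrib_left mult_ac)

section \<open>Positivity of the moments for ordered jumps\<close>

definition ordered_upto :: "nat \<Rightarrow> (nat \<Rightarrow> real) \<Rightarrow> bool" where
  "ordered_upto m t \<longleftrightarrow> (\<forall>k. 1 \<le> k \<and> k < m \<longrightarrow> t k < t (Suc k))"

lemma ordered_uptoD:
  assumes "ordered_upto m t" "1 \<le> j" "j < k" "k \<le> m"
  shows "t j < t k"
  using assms(3,4)
proof (induction k)
  case (Suc k)
  have "t k < t (Suc k)" if "j \<le> k"
    using assms(1,2) that Suc.prems by (auto simp: ordered_upto_def)
  thus ?case using Suc by (cases "j = k") (auto intro: less_trans)
qed simp

text \<open>Finitely many strict inequalities form an open condition. This allows identities proved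
  for ordered positions to be differentiated.\<close>

lemma eventually_ordered_upto:
  assumes "ordered_upto m t"
  shows "eventually (\<lambda>s. ordered_upto m (t(j := s))) (nhds (t j))"
proof -
  have tend: "((\<lambda>s. (t(j := s)) i) \<longlongrightarrow> t i) (nhds (t j))" for i
    by (cases "i = j") (auto simp: filterlim_ident)
  have "eventually (\<lambda>s. \<forall>k\<in>{1..<m}. (t(j := s)) (Suc k) - (t(j := s)) k > 0) (nhds (t j))"
  proof (intro eventually_ball_finite ballI)
    fix k assume "k \<in> {1..<m}"
    hence "t (Suc k) - t k > 0" using assms by (auto simp: ordered_upto_def)
    thus "eventually (\<lambda>s. (t(j := s)) (Suc k) - (t(j := s)) k > 0) (nhds (t j))"
      by (rule order_tendstoD(1)[OF tendsto_diff[OF tend tend]])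
  qed simp
  thus ?thesis by (rule eventually_mono) (auto simp: ordered_upto_def simp del: fun_upd_apply)
qed

lemma wgt_on_gap:
  assumes "l \<le> m" "\<And>k. 1 \<le> k \<Longrightarrow> k \<le> l \<Longrightarrow> t k < x" "\<And>k. l < k \<Longrightarrow> k \<le> m \<Longrightarrow> x \<le> t k"
  shows "wgt m \<omega> t x = exp (- x\<^sup>2) * (\<Sum>k=0..l. \<omega> k)"
proof -
  have "(\<Sum>k=1..m. \<omega> k * theta (x - t k)) = (\<Sum>k=1..l. \<omega> k)"
  proof (rule sum.mono_neutral_cong_right)
    show "\<forall>k\<in>{1..m} - {1..l}. \<omega> k * theta (x - t k) = 0"
    proof
      fix k assume "k \<in> {1..m} - {1..l}"
      hence "x \<le> t k" by (intro assms(3)) auto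
      thus "\<omega> k * theta (x - t k) = 0" by (simp add: theta_def)
    qed
    show "\<omega> k * theta (x - t k) = \<omega> k" if "k \<in> {1..l}" for k
      using assms(2)[of k] that by (simp add: theta_def)
  qed (use assms(1) in auto)
  thus ?thesis by (simp add: wgt_def sum.atLeast_Suc_atMost[of 0 l])
qed

lemma gap_exists:
  assumes "ordered_upto m t"
  shows "\<exists>l\<le>m. (\<forall>k. 1 \<le> k \<and> k \<le> l \<longrightarrow> t k < x) \<and> (\<forall>k. l < k \<and> k \<le> m \<longrightarrow> x \<le> t k)"
proof -
  \<comment> \<open>The index of the last jump below \<open>x\<close> is the maximum; the inserted 0
    stands for the gap to the left of all jumps.\<close>
  define S where "S = insert 0 {k\<in>{1..m}. t k < x}"
  have S: "finite S" "S \<noteq> {}" by (auto simp: S_def)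
  define l where "l = Max S"
  have "l \<in> S" using S Max_in l_def by simp
  hence l: "l \<le> m" "l \<noteq> 0 \<Longrightarrow> t l < x" by (auto simp: S_def)
  have "t k < x" if "1 \<le> k" "k \<le> l" for k
    using ordered_uptoD[OF assms, of k l] l that by (cases "k = l") auto
  moreover have "x \<le> t k" if "l < k" "k \<le> m" for k
  proof (rule ccontr)
    assume "\<not> x \<le> t k"
    hence "k \<in> S" using that by (auto simp: S_def)
    hence "k \<le> l" using S l_def by simp
    thus False using that by simp
  qed
  ultimately show ?thesis using l by auto
qed

text \<open>The partial sums are the values of the step factor on the successive gaps. Stating that
  the weight does not vanish through \<open>\<omega>\<close> alone makes the condition independent
  of the jump positions.\<close>

definition valid_jumps :: "nat \<Rightarrow> (nat \<Rightarrow> real) \<Rightarrow> bool" where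
  "valid_jumps m \<omega> \<longleftrightarrow> (\<forall>l\<le>m. (\<Sum>k=0..l. \<omega> k) \<ge> 0) \<and> (\<exists>l\<le>m. (\<Sum>k=0..l. \<omega> k) > 0)"

lemma valid_jumpsI:
  assumes "ordered_upto m t" "\<forall>l\<le>m. (\<Sum>k=0..l. \<omega> k) \<ge> 0" "\<exists>x. wgt m \<omega> t x \<noteq> 0"
  shows "valid_jumps m \<omega>"
proof -
  obtain x where x: "wgt m \<omega> t x \<noteq> 0" using assms by blast
  obtain l where l: "l \<le> m" "\<And>k. 1 \<le> k \<Longrightarrow> k \<le> l \<Longrightarrow> t k < x" "\<And>k. l < k \<Longrightarrow> k \<le> m \<Longrightarrow> x \<le> t k"
    using gap_exists[OF assms(1), of x] by blast
  have "(\<Sum>k=0..l. \<omega> k) \<noteq> 0"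
    using x wgt_on_gap[OF l] by auto
  moreover have "(\<Sum>k=0..l. \<omega> k) \<ge> 0" using assms(2) l(1) by blast
  ultimately have "(\<Sum>k=0..l. \<omega> k) > 0" by linarith
  thus ?thesis using assms(2) l(1) by (auto simp: valid_jumps_def)
qed

text \<open>The weight is nonnegative, and positive on some gap. If the integral were zero, that gap
  would lie, up to a null set, in the finite root set of \<open>p\<close>.\<close>

lemma pos_moments_moment:
  assumes "ordered_upto m t" "valid_jumps m \<omega>"
  shows "pos_moments (moment m \<omega> t)"
  unfolding pos_moments_def
proof safe
  fix p :: "real poly" assume "p \<noteq> 0"
  let ?f = "\<lambda>x. poly (p * p) x * wgt m \<omega> t x"
  have wnn: "wgt m \<omega> t x \<ge> 0" for x
    using gap_exists[OF assms(1), of x] wgt_on_gap[of _ m t x \<omega>] assms(2)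
    by (auto simp: valid_jumps_def)
  hence nn: "?f x \<ge> 0" for x by simp
  obtain l where l: "l \<le> m" "(\<Sum>k=0..l. \<omega> k) > 0"
    using assms(2) by (auto simp: valid_jumps_def)
  \<comment> \<open>An interval inside the gap of index \<open>l\<close>; when the gap is unbounded,
    a piece of length 1 is taken.\<close>
  define a where "a = (if l = 0 then t 1 - 1 else t l)"
  define b where "b = (if l = m then a + 1 else t (Suc l))"
  have "a < b"
    using ordered_uptoD[OF assms(1), of l "Suc l"] l by (auto simp: a_def b_def)
  have wpos: "wgt m \<omega> t x > 0" if "x \<in> {a<..<b}" for x
  proof -
    have "t k < x" if "1 \<le> k" "k \<le> l" for k
      using ordered_uptoD[OF assms(1), of k l] l that \<open>x \<in> {a<..<b}\<close>
      by (cases "k = l") (auto simp: a_def)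
    moreover have "x \<le> t k" if "l < k" "k \<le> m" for k
      using ordered_uptoD[OF assms(1), of "Suc l" k] l that \<open>x \<in> {a<..<b}\<close>
      by (cases "k = Suc l") (auto simp: b_def)
    ultimately show ?thesis using l wgt_on_gap[of l m t x \<omega>] by simp
  qed
  have "integral\<^sup>L lborel ?f \<noteq> 0"
  proof
    assume "integral\<^sup>L lborel ?f = 0"
    moreover have "integral\<^sup>L lborel ?f = 0 \<longleftrightarrow> (AE x in lborel. ?f x = 0)"
      by (rule integral_nonneg_eq_0_iff_AE[OF integrable_poly_wgt]) (rule AE_I2, rule nn)
    ultimately have "AE x in lborel. ?f x = 0" by blast
    moreover have "AE x in lborel. x \<notin> {x. poly p x = 0}"
      by (rule AE_not_in) (intro finite_imp_null_set_lborel poly_roots_finite \<open>p \<noteq> 0\<close>)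
    ultimately have "AE x in lborel. x \<notin> {a<..<b}"
    proof eventually_elim
      case (elim x)
      thus ?case using wpos[of x] by auto
    qed
    moreover have "(AE x in lborel. x \<notin> {a<..<b}) \<longleftrightarrow> emeasure lborel {a<..<b} = 0"
      by (rule AE_iff_measurable) auto
    ultimately have "emeasure lborel {a<..<b} = 0" by blast
    thus False using \<open>a < b\<close> by simp
  qed
  moreover have "integral\<^sup>L lborel ?f \<ge> 0" using nn by simp
  ultimately show "mlin (moment m \<omega> t) (p * p) > 0" unfolding mlin_moment by simp
qed

section \<open>Orthogonal polynomials depending on a parameter\<close>

text \<open>Differentiability of a curve in a space of polynomials of bounded degree. The uniform
  bound reduces functionals and evaluations to sums over a fixed finite range.\<close>

definition has_coeff_deriv :: "(real \<Rightarrow> real poly) \<Rightarrow> real poly \<Rightarrow> real \<Rightarrow> bool" where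
  "has_coeff_deriv p p' x \<longleftrightarrow> (\<exists>N. \<forall>s. degree (p s) \<le> N) \<and>
     (\<forall>i. ((\<lambda>s. coeff (p s) i) has_real_derivative coeff p' i) (at x))"

lemma has_coeff_derivD:
  "has_coeff_deriv p p' x \<Longrightarrow> ((\<lambda>s. coeff (p s) i) has_real_derivative coeff p' i) (at x)"
  by (simp add: has_coeff_deriv_def)

lemma has_coeff_deriv_coeff_eq_0:
  assumes "has_coeff_deriv p p' x" "\<And>s. coeff (p s) i = c"
  shows "coeff p' i = 0"
proof -
  have "((\<lambda>s. coeff (p s) i) has_real_derivative 0) (at x)"
    unfolding assms(2) by (rule DERIV_const)
  with has_coeff_derivD[OF assms(1), of i] show ?thesis by (rule DERIV_unique)
qed

lemma has_coeff_deriv_degree: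
  assumes "has_coeff_deriv p p' x"
  shows "\<exists>N. (\<forall>s. degree (p s) \<le> N) \<and> degree p' \<le> N"
proof -
  obtain N where N: "\<And>s. degree (p s) \<le> N"
    using assms by (auto simp: has_coeff_deriv_def)
  have "coeff p' i = 0" if "i > N" for i
  proof (rule has_coeff_deriv_coeff_eq_0[OF assms])
    show "coeff (p s) i = 0" for s using N[of s] that by (simp add: coeff_eq_0)
  qed
  hence "degree p' \<le> N" by (intro degree_le) auto
  with N show ?thesis by blast
qed

lemma has_coeff_deriv_const: "has_coeff_deriv (\<lambda>_. p) 0 x"
  by (auto simp: has_coeff_deriv_def)

lemma has_coeff_deriv_diff:
  assumes "has_coeff_deriv p p' x" "has_coeff_deriv q q' x"
  shows "has_coeff_deriv (\<lambda>s. p s - q s) (p' - q') x"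
proof -
  obtain N M where "(\<forall>s. degree (p s) \<le> N) \<and> degree p' \<le> N" "(\<forall>s. degree (q s) \<le> M) \<and> degree q' \<le> M"
    using has_coeff_deriv_degree[OF assms(1)] has_coeff_deriv_degree[OF assms(2)] by (elim exE)
  hence "degree (p s - q s) \<le> max N M" for s
    by (intro degree_diff_le) (auto simp: le_max_iff_disj)
  moreover have "((\<lambda>s. coeff (p s - q s) i) has_real_derivative coeff (p' - q') i) (at x)" for i
    unfolding coeff_diff by (intro DERIV_diff has_coeff_derivD assms)
  ultimately show ?thesis unfolding has_coeff_deriv_def by blast
qed

lemma has_coeff_deriv_mult:
  assumes "has_coeff_deriv p p' x" "has_coeff_deriv q q' x"
  shows "has_coeff_deriv (\<lambda>s. p s * q s) (p' * q x + p x * q') x"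
proof -
  obtain N M where NM: "(\<forall>s. degree (p s) \<le> N) \<and> degree p' \<le> N" "(\<forall>s. degree (q s) \<le> M) \<and> degree q' \<le> M"
    using has_coeff_deriv_degree[OF assms(1)] has_coeff_deriv_degree[OF assms(2)] by (elim exE)
  have "degree (p s * q s) \<le> N + M" for s
    using NM by (intro order_trans[OF degree_mult_le] add_mono) auto
  moreover have "((\<lambda>s. coeff (p s * q s) i) has_real_derivative coeff (p' * q x + p x * q') i) (at x)" for i
  proof -
    have "((\<lambda>s. \<Sum>j\<le>i. coeff (p s) j * coeff (q s) (i - j)) has_real_derivative
      (\<Sum>j\<le>i. coeff p' j * coeff (q x) (i - j) + coeff q' (i - j) * coeff (p x) j)) (at x)"
      by (intro DERIV_sum DERIV_mult has_coeff_derivD assms)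
    moreover have "coeff (p' * q x + p x * q') i
      = (\<Sum>j\<le>i. coeff p' j * coeff (q x) (i - j) + coeff q' (i - j) * coeff (p x) j)"
      unfolding coeff_add coeff_mult sum.distrib[symmetric] by (intro sum.cong refl) simp
    ultimately show ?thesis by (simp only: coeff_mult)
  qed
  ultimately show ?thesis unfolding has_coeff_deriv_def by blast
qed

lemma has_coeff_deriv_smult:
  assumes "(c has_real_derivative c') (at x)" "has_coeff_deriv q q' x"
  shows "has_coeff_deriv (\<lambda>s. smult (c s) (q s)) (smult c' (q x) + smult (c x) q') x"
proof -
  have "has_coeff_deriv (\<lambda>s. [:c s:]) [:c':] x"
    using assms(1) by (auto simp: has_coeff_deriv_def coeff_pCons intro!: exI[of _ 0] split: nat.splits)
  from has_coeff_deriv_mult[OF this assms(2)] show ?thesis by simp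
qed

lemma has_coeff_deriv_sum:
  assumes "finite A" "\<And>j. j \<in> A \<Longrightarrow> has_coeff_deriv (p j) (p' j) x"
  shows "has_coeff_deriv (\<lambda>s. \<Sum>j\<in>A. p j s) (\<Sum>j\<in>A. p' j) x"
  using assms
proof (induction A rule: finite_induct)
  case empty
  thus ?case by (simp add: has_coeff_deriv_const)
next
  case (insert a A)
  \<comment> \<open>The sum is written as a difference of differences so that
    \<open>has_coeff_deriv_diff\<close> applies.\<close>
  have "has_coeff_deriv (\<lambda>s. p a s - (0 - (\<Sum>j\<in>A. p j s))) (p' a - (0 - (\<Sum>j\<in>A. p' j))) x"
    using insert by (intro has_coeff_deriv_diff has_coeff_deriv_const) auto
  thus ?case using insert by simp
qed

lemma has_real_derivative_mlin:
  assumes "has_coeff_deriv p p' x" "\<And>i. ((\<lambda>s. \<mu> s i) has_real_derivative \<mu>' i) (at x)"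
  shows "((\<lambda>s. mlin (\<mu> s) (p s)) has_real_derivative mlin (\<mu> x) p' + mlin \<mu>' (p x)) (at x)"
proof -
  obtain N where "(\<forall>s. degree (p s) \<le> N) \<and> degree p' \<le> N"
    using has_coeff_deriv_degree[OF assms(1)] by (elim exE)
  hence N: "\<And>s. degree (p s) \<le> N" "degree p' \<le> N" by auto
  have "((\<lambda>s. \<Sum>i\<le>N. coeff (p s) i * \<mu> s i) has_real_derivative
      (\<Sum>i\<le>N. coeff p' i * \<mu> x i + \<mu>' i * coeff (p x) i)) (at x)"
    by (intro DERIV_sum DERIV_mult has_coeff_derivD assms)
  thus ?thesis by (simp add: mlin_degree_le[of _ N] N sum.distrib mult.commute)
qed

lemma has_real_derivative_poly:
  assumes "has_coeff_deriv p p' x" "(c has_real_derivative c') (at x)"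
  shows "((\<lambda>s. poly (p s) (c s)) has_real_derivative
     poly p' (c x) + poly (pderiv (p x)) (c x) * c') (at x)"
proof -
  obtain N where "(\<forall>s. degree (p s) \<le> N) \<and> degree p' \<le> N"
    using has_coeff_deriv_degree[OF assms(1)] by (elim exE)
  hence N: "\<And>s. degree (p s) \<le> N" "degree p' \<le> N" by auto
  have pe: "poly q y = (\<Sum>i\<le>N. coeff q i * y ^ i)" if "degree q \<le> N" for q and y :: real
    unfolding poly_altdef using that by (intro sum.mono_neutral_left) (auto intro: coeff_eq_0)
  \<comment> \<open>Differentiating this function of \<open>y\<close> in two ways expresses
    \<open>pderiv (p x)\<close> by a sum over the same range up to \<open>N\<close>.\<close>
  have "poly (p x) = (\<lambda>y. \<Sum>i\<le>N. coeff (p x) i * y ^ i)"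
    using pe[OF N(1)] by auto
  hence "((\<lambda>y. \<Sum>i\<le>N. coeff (p x) i * y ^ i) has_real_derivative poly (pderiv (p x)) (c x)) (at (c x))"
    using poly_DERIV[of "p x" "c x"] by simp
  moreover have "((\<lambda>y. \<Sum>i\<le>N. coeff (p x) i * y ^ i) has_real_derivative
      (\<Sum>i\<le>N. coeff (p x) i * (real i * c x ^ (i - 1)))) (at (c x))"
    by (auto intro!: derivative_eq_intros sum.cong)
  ultimately have pd: "poly (pderiv (p x)) (c x) = (\<Sum>i\<le>N. coeff (p x) i * (real i * c x ^ (i - 1)))"
    by (rule DERIV_unique)
  have "((\<lambda>s. \<Sum>i\<le>N. coeff (p s) i * c s ^ i) has_real_derivative
      (\<Sum>i\<le>N. coeff p' i * c x ^ i + (real i * (c' * c x ^ (i - Suc 0))) * coeff (p x) i)) (at x)"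
    by (intro DERIV_sum DERIV_mult DERIV_power has_coeff_derivD assms)
  thus ?thesis
    by (simp add: pe N pd sum.distrib sum_distrib_left mult_ac)
qed

text \<open>Strong induction along Gram-Schmidt; positivity at \<open>x\<close> keeps the
  denominators nonzero there, so the quotient rule applies.\<close>

lemma orthp_has_coeff_deriv:
  assumes "pos_moments (\<mu> x)" "\<And>i. ((\<lambda>s. \<mu> s i) has_real_derivative \<mu>' i) (at x)"
  shows "\<exists>p'. has_coeff_deriv (\<lambda>s. orthp (\<mu> s) n) p' x"
proof (induction n rule: less_induct)
  case (less n)
  interpret pos_moment_functional "\<mu> x" by standard fact
  have "\<forall>j\<in>{..<n}. \<exists>p'. has_coeff_deriv (\<lambda>s. orthp (\<mu> s) j) p' x"
    using less by simp
  from bchoice[OF this] obtain p' where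
    "\<forall>j\<in>{..<n}. has_coeff_deriv (\<lambda>s. orthp (\<mu> s) j) (p' j) x" ..
  hence p': "has_coeff_deriv (\<lambda>s. orthp (\<mu> s) j) (p' j) x" if "j < n" for j
    using that by simp
  let ?c = "\<lambda>j s. mlin (\<mu> s) (monom 1 n * orthp (\<mu> s) j) / mlin (\<mu> s) (orthp (\<mu> s) j * orthp (\<mu> s) j)"
  have "\<forall>j\<in>{..<n}. \<exists>c'. ((\<lambda>s. ?c j s) has_real_derivative c') (at x)"
  proof
    fix j assume "j \<in> {..<n}"
    hence that: "j < n" by simp
    have "mlin (\<mu> x) (orthp (\<mu> x) j * orthp (\<mu> x) j) \<noteq> 0"
      using onorm2_nonzero[of j] by (simp add: onorm2_def)
    from DERIV_divide[OF
        has_real_derivative_mlin[where \<mu> = \<mu>, OF has_coeff_deriv_mult[OF has_coeff_deriv_const[of "monom 1 n"] p'[OF that]] assms(2)]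
        has_real_derivative_mlin[where \<mu> = \<mu>, OF has_coeff_deriv_mult[OF p'[OF that] p'[OF that]] assms(2)] this]
    show "\<exists>c'. ((\<lambda>s. ?c j s) has_real_derivative c') (at x)" by (rule exI)
  qed
  from bchoice[OF this] obtain c' where
    "\<forall>j\<in>{..<n}. ((\<lambda>s. ?c j s) has_real_derivative c' j) (at x)" ..
  hence c': "((\<lambda>s. ?c j s) has_real_derivative c' j) (at x)" if "j < n" for j
    using that by simp
  have "has_coeff_deriv (\<lambda>s. monom 1 n - (\<Sum>j<n. smult (?c j s) (orthp (\<mu> s) j)))
     (0 - (\<Sum>j<n. smult (c' j) (orthp (\<mu> x) j) + smult (?c j x) (p' j))) x"
    by (intro has_coeff_deriv_diff has_coeff_deriv_const has_coeff_deriv_sum has_coeff_deriv_smult)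
      (auto intro: p' c')
  thus ?case by (subst orthp.simps) (rule exI)
qed

text \<open>The monic normalization freezes the leading coefficient. Hence the derivative has lower
  degree and is orthogonal to the polynomial itself.\<close>

lemma orthp_coeff_deriv_degree:
  assumes "has_coeff_deriv (\<lambda>s. orthp (\<mu> s) n) p' x" "i \<ge> n"
  shows "coeff p' i = 0"
  by (rule has_coeff_deriv_coeff_eq_0[OF assms(1), of _ "if i = n then 1 else 0"])
    (use assms(2) in \<open>auto simp: coeff_orthp_eq_0\<close>)

text \<open>Both terms with the derivative of the polynomial vanish by orthogonality, so only the
  derivative of the functional contributes.\<close>

lemma has_real_derivative_onorm2:
  assumes "pos_moments (\<mu> x)" "\<And>i. ((\<lambda>s. \<mu> s i) has_real_derivative \<mu>' i) (at x)"
  shows "((\<lambda>s. onorm2 (\<mu> s) n) has_real_derivative mlin \<mu>' (orthp (\<mu> x) n * orthp (\<mu> x) n)) (at x)"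
proof -
  interpret pos_moment_functional "\<mu> x" by standard fact
  obtain p' where p': "has_coeff_deriv (\<lambda>s. orthp (\<mu> s) n) p' x"
    using orthp_has_coeff_deriv[of \<mu> x \<mu>' n] assms by blast
  have "L (p' * P n) = 0"
    by (rule orthp_orthogonal_lower) (rule orthp_coeff_deriv_degree[OF p'])
  hence "L (p' * P n + P n * p') = 0" by (simp only: mlin_add mult.commute)
  with has_real_derivative_mlin[where \<mu> = \<mu>, OF has_coeff_deriv_mult[OF p' p'] assms(2)] show ?thesis
    by (simp add: onorm2_def)
qed

text \<open>Differentiate the orthogonality of the two polynomials, valid in a neighbourhood of
  \<open>x\<close>; the term with the derivative of the one of index \<open>j\<close> vanishes by
  degree.\<close>

lemma orthp_coeff_deriv_tested:
  assumes "pos_moments (\<mu> x)" "\<And>i. ((\<lambda>s. \<mu> s i) has_real_derivative \<mu>' i) (at x)"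
    and ev: "eventually (\<lambda>s. pos_moments (\<mu> s)) (nhds x)"
    and p': "has_coeff_deriv (\<lambda>s. orthp (\<mu> s) n) p' x" and "j < n"
  shows "mlin (\<mu> x) (p' * orthp (\<mu> x) j) = - mlin \<mu>' (orthp (\<mu> x) n * orthp (\<mu> x) j)"
proof -
  interpret pos_moment_functional "\<mu> x" by standard fact
  obtain q' where q': "has_coeff_deriv (\<lambda>s. orthp (\<mu> s) j) q' x"
    using orthp_has_coeff_deriv[of \<mu> x \<mu>' j] assms by blast
  have "L (q' * P n) = 0"
    by (rule orthp_orthogonal_lower) (rule orthp_coeff_deriv_degree[OF q'], use \<open>j < n\<close> in simp)
  moreover have "((\<lambda>s. mlin (\<mu> s) (orthp (\<mu> s) n * orthp (\<mu> s) j)) has_real_derivative 0) (at x)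
     \<longleftrightarrow> ((\<lambda>s. 0) has_real_derivative 0) (at x)"
    by (rule DERIV_cong_ev[OF refl _ refl], rule eventually_mono[OF ev])
      (simp add: pos_moment_functional.orthp_orthogonal[OF pos_moment_functional.intro] \<open>j < n\<close>)
  hence "((\<lambda>s. mlin (\<mu> s) (orthp (\<mu> s) n * orthp (\<mu> s) j)) has_real_derivative 0) (at x)"
    by simp
  with has_real_derivative_mlin[where \<mu> = \<mu>, OF has_coeff_deriv_mult[OF p' q'] assms(2)]
  have "L (p' * P j + P n * q') + mlin \<mu>' (P n * P j) = 0"
    by (rule DERIV_unique)
  ultimately show ?thesis by (simp add: mlin_add mult.commute)
qed

section \<open>Derivatives with respect to the jump positions\<close>

definition jump :: "(nat \<Rightarrow> real) \<Rightarrow> (nat \<Rightarrow> real) \<Rightarrow> nat \<Rightarrow> real" where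
  "jump \<omega> t k = \<omega> k * exp (- (t k)\<^sup>2)"

text \<open>Half the derivative of \<open>sigma m \<omega> (Suc n)\<close> in \<open>t k\<close>.
  From here on the index of the determinant is \<open>Suc n\<close>, so that its predecessor
  \<open>n\<close> is always available.\<close>

definition rfun :: "nat \<Rightarrow> (nat \<Rightarrow> real) \<Rightarrow> nat \<Rightarrow> nat \<Rightarrow> (nat \<Rightarrow> real) \<Rightarrow> real" where
  "rfun m \<omega> n k t = jump \<omega> t k * (poly (orthp (moment m \<omega> t) (Suc n)) (t k) * poly (orthp (moment m \<omega> t) n) (t k))
     / onorm2 (moment m \<omega> t) n"

locale jump_weight =
  fixes m :: nat and \<omega> t :: "nat \<Rightarrow> real"
  assumes valid: "valid_jumps m \<omega>" and ordered: "ordered_upto m t"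
begin

sublocale pos_moment_functional "moment m \<omega> t"
  by standard (rule pos_moments_moment[OF ordered valid])

abbreviation "c \<equiv> jump \<omega> t"

text \<open>Every result of this locale also holds at nearby positions, and can therefore be
  differentiated.\<close>

lemma eventually_jump_weight: "eventually (\<lambda>s. jump_weight m \<omega> (t(k := s))) (nhds (t k))"
  using eventually_ordered_upto[OF ordered, of k]
  by (rule eventually_mono) (simp add: jump_weight_def valid)

lemma eventually_pos_moments: "eventually (\<lambda>s. pos_moments (moment m \<omega> (t(k := s)))) (nhds (t k))"
  using eventually_ordered_upto[OF ordered, of k]
  by (rule eventually_mono) (rule pos_moments_moment[OF _ valid])

lemma moment_has_derivative':
  "k \<in> {1..m} \<Longrightarrow> ((\<lambda>s. moment m \<omega> (t(k := s)) i) has_real_derivative - c k * t k ^ i) (at (t k))"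
  using moment_has_derivative[of k m \<omega> t i] by (simp add: jump_def)

section \<open>Sums over the jumps by integration by parts\<close>

lemma sum_jump_poly:
  "(\<Sum>k=1..m. c k * poly p (t k)) = 2 * L (mulx p) - L (pderiv p)"
  using mlin_moment_ibp[of m \<omega> t p] by (simp add: jump_def)

lemma sum_jump_sq: "(\<Sum>k=1..m. c k * (poly (P n) (t k))\<^sup>2) = 2 * \<alpha> n * h n"
  using sum_jump_poly[of "P n * P n"] mlin_pderiv_self[of n] mlin_mulx_orthp_sq[of n]
  by (simp add: power2_eq_square)

lemma sum_jump_consecutive:
  "(\<Sum>k=1..m. c k * (poly (P (Suc n)) (t k) * poly (P n) (t k))) = 2 * h (Suc n) - real (Suc n) * h n"
  using sum_jump_poly[of "P (Suc n) * P n"] mlin_pderiv_prod[of n] mlin_mulx_consecutive[of n]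
  by simp

lemma sum_jump_consecutive_mulx:
  "(\<Sum>k=1..m. c k * (t k * (poly (P (Suc n)) (t k) * poly (P n) (t k))))
     = 2 * (\<alpha> (Suc n) + \<alpha> n) * h (Suc n) + subl (moment m \<omega> t) (Suc n) * h n"
  using sum_jump_poly[of "mulx (P (Suc n) * P n)"] mlin_pderiv_mulx_prod[of n] mlin_mulx2[of n]
  by simp

section \<open>First derivatives of the determinant and of sigma\<close>

lemma onorm2_has_derivative:
  assumes "k \<in> {1..m}"
  shows "((\<lambda>s. onorm2 (moment m \<omega> (t(k := s))) n) has_real_derivative - c k * (poly (P n) (t k))\<^sup>2) (at (t k))"
  using has_real_derivative_onorm2[of "\<lambda>s. moment m \<omega> (t(k := s))" "t k" "\<lambda>i. - c k * t k ^ i" n]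
    moment_has_derivative'[OF assms] pos
  unfolding mlin_powers by (simp add: power2_eq_square)

lemma hankelD_eq: "hankelD m \<omega> n t = (\<Prod>j<n. h j)"
  unfolding hankelD_def by (rule det_nat_eq_prod_onorm2[OF pos])

lemma ln_hankelD_eq: "ln (hankelD m \<omega> n t) = (\<Sum>j<n. ln (h j))"
  unfolding hankelD_eq by (rule ln_prod) (auto simp: onorm2_pos)

lemma ln_hankelD_has_derivative:
  assumes "k \<in> {1..m}"
  shows "((\<lambda>s. ln (hankelD m \<omega> n (t(k := s)))) has_real_derivative
     (\<Sum>j<n. - c k * (poly (P j) (t k))\<^sup>2 / h j)) (at (t k))"
proof -
  have "((\<lambda>s. ln (onorm2 (moment m \<omega> (t(k := s))) j)) has_real_derivative
     1 / h j * (- c k * (poly (P j) (t k))\<^sup>2)) (at (t k))" for j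
    using DERIV_chain2[OF DERIV_ln_divide, OF _ onorm2_has_derivative[OF assms, of j]] onorm2_pos[of j]
    by simp
  hence "((\<lambda>s. \<Sum>j<n. ln (onorm2 (moment m \<omega> (t(k := s))) j)) has_real_derivative
     (\<Sum>j<n. 1 / h j * (- c k * (poly (P j) (t k))\<^sup>2))) (at (t k))"
    by (rule DERIV_sum)
  moreover have "eventually (\<lambda>s. ln (hankelD m \<omega> n (t(k := s)))
      = (\<Sum>j<n. ln (onorm2 (moment m \<omega> (t(k := s))) j))) (nhds (t k))"
    using eventually_jump_weight by (rule eventually_mono) (rule jump_weight.ln_hankelD_eq)
  ultimately show ?thesis by (subst DERIV_cong_ev[OF refl _ refl]) simp_all
qed

text \<open>After exchanging the sums, the jumps contribute \<open>2 * \<alpha> j\<close> for each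
  \<open>j\<close>, and the sum of the \<open>\<alpha> j\<close> telescopes to the subleading
  coefficient.\<close>

lemma sigma_eq: "sigma m \<omega> n t = 2 * subl (moment m \<omega> t) n"
proof -
  have "sigma m \<omega> n t = (\<Sum>k=1..m. \<Sum>j<n. - c k * (poly (P j) (t k))\<^sup>2 / h j)"
    unfolding sigma_def partial_deriv_def
    by (intro sum.cong refl DERIV_imp_deriv ln_hankelD_has_derivative)
  also have "\<dots> = (\<Sum>j<n. \<Sum>k=1..m. - c k * (poly (P j) (t k))\<^sup>2 / h j)"
    by (rule sum.swap)
  also have "\<dots> = (\<Sum>j<n. - (\<Sum>k=1..m. c k * (poly (P j) (t k))\<^sup>2) / h j)"
    by (simp add: sum_negf sum_divide_distrib)
  also have "\<dots> = 2 * subl (moment m \<omega> t) n"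
    unfolding sum_jump_sq subl_eq_sum_alph by (simp add: sum_distrib_left sum_negf)
  finally show ?thesis .
qed

lemma orthp_derivative:
  assumes "k \<in> {1..m}"
  obtains Q where "has_coeff_deriv (\<lambda>s. orthp (moment m \<omega> (t(k := s))) n) Q (t k)"
    "\<And>i. i \<ge> n \<Longrightarrow> coeff Q i = 0"
    "\<And>j. j < n \<Longrightarrow> L (Q * P j) = c k * poly (P n * P j) (t k)"
proof -
  let ?\<mu> = "\<lambda>s. moment m \<omega> (t(k := s))" and ?\<mu>' = "\<lambda>i. - c k * t k ^ i"
  have p: "pos_moments (?\<mu> (t k))" using pos by simp
  obtain Q where Q: "has_coeff_deriv (\<lambda>s. orthp (?\<mu> s) n) Q (t k)"
    using orthp_has_coeff_deriv[of ?\<mu> "t k" ?\<mu>' n, OF p moment_has_derivative'[OF assms]] by blast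
  have "L (Q * P j) = c k * poly (P n * P j) (t k)" if "j < n" for j
    using orthp_coeff_deriv_tested[of ?\<mu> "t k" ?\<mu>' n, OF p moment_has_derivative'[OF assms]
        eventually_pos_moments Q that]
    unfolding mlin_powers by simp
  with Q orthp_coeff_deriv_degree[OF Q] show thesis by (intro that)
qed

text \<open>By \<open>sigma_eq\<close> the task is the coefficient of degree \<open>n\<close> in the
  derivative of \<open>P (Suc n)\<close>. That derivative has degree at most \<open>n\<close>, so
  pairing it with \<open>P n\<close> reads the coefficient off.\<close>

lemma sigma_has_derivative:
  assumes "k \<in> {1..m}"
  shows "((\<lambda>s. sigma m \<omega> (Suc n) (t(k := s))) has_real_derivative 2 * rfun m \<omega> n k t) (at (t k))"
proof -
  obtain Q where Q: "has_coeff_deriv (\<lambda>s. orthp (moment m \<omega> (t(k := s))) (Suc n)) Q (t k)"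
    "\<And>i. i \<ge> Suc n \<Longrightarrow> coeff Q i = 0"
    "\<And>j. j < Suc n \<Longrightarrow> L (Q * P j) = c k * poly (P (Suc n) * P j) (t k)"
    using orthp_derivative[OF assms] by blast
  have "L (Q * P n) = coeff Q n * h n"
    by (rule mlin_times_orthp) (use Q(2) in auto)
  hence "coeff Q n = rfun m \<omega> n k t"
    using Q(3)[of n] by (simp add: rfun_def field_simps)
  with has_coeff_derivD[OF Q(1), of n]
  have "((\<lambda>s. 2 * subl (moment m \<omega> (t(k := s))) (Suc n)) has_real_derivative 2 * rfun m \<omega> n k t) (at (t k))"
    unfolding subl_Suc by (intro DERIV_cmult) simp
  moreover have "eventually (\<lambda>s. sigma m \<omega> (Suc n) (t(k := s))
      = 2 * subl (moment m \<omega> (t(k := s))) (Suc n)) (nhds (t k))"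
    using eventually_jump_weight by (rule eventually_mono) (rule jump_weight.sigma_eq)
  ultimately show ?thesis by (subst DERIV_cong_ev[OF refl _ refl]) simp_all
qed

lemma partial_deriv_sigma:
  "k \<in> {1..m} \<Longrightarrow> partial_deriv k (sigma m \<omega> (Suc n)) t = 2 * rfun m \<omega> n k t"
  unfolding partial_deriv_def by (intro DERIV_imp_deriv sigma_has_derivative)

text \<open>Here \<open>Q j\<close> stands for the derivative of \<open>P n\<close> with respect to \<open>t j\<close>.\<close>
lemma shift_orthp:
  assumes "\<And>j i. j \<in> {1..m} \<Longrightarrow> i \<ge> n \<Longrightarrow> coeff (Q j) i = 0"
    "\<And>j i. j \<in> {1..m} \<Longrightarrow> i < n \<Longrightarrow> L (Q j * P i) = c j * poly (P n * P i) (t j)"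
  shows "(\<Sum>j=1..m. Q j) + pderiv (P n) = smult 2 (mulx (P n) - smult (\<alpha> n) (P n) - P (Suc n))"
    (is "?S = smult 2 ?T")
\<comment> \<open>The left side is the infinitesimal effect of shifting all jumps and the argument
  together; it is identified by testing against \<open>P i\<close>.\<close>
proof (rule poly_eq_if_tested_orthp[of _ n])
  have S: "coeff ?S i = 0" if "i \<ge> n" for i
    using assms(1) that by (simp add: coeff_sum coeff_pderiv coeff_orthp_eq_0)
  thus "degree ?S \<le> n" by (intro degree_le) auto
  have "coeff ?T i = 0" if "i > n" for i
    using that by (cases "i = Suc n") (auto simp: coeff_orthp_eq_0 coeff_pCons split: nat.splits)
  thus "degree (smult 2 ?T) \<le> n" by (intro degree_le) auto
  fix i assume "i \<le> n"
  have T: "L (smult 2 ?T * P i) = 2 * (L (mulx (P n * P i)) - \<alpha> n * L (P n * P i))"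
    using orthp_orthogonal[of i "Suc n"] \<open>i \<le> n\<close>
    by (simp only: mult_smult_left mlin_smult left_diff_distrib mlin_diff mult_pCons_left) simp
  show "L (?S * P i) = L (smult 2 ?T * P i)"
  proof (cases "i = n")
    case True
    have "L (?S * P n) = 0" by (rule orthp_orthogonal_lower) (rule S)
    thus ?thesis unfolding T using True mlin_mulx_orthp_sq[of n] by (simp add: onorm2_def)
  next
    case False
    with \<open>i \<le> n\<close> have "i < n" by simp
    have "L (?S * P i) = (\<Sum>j=1..m. L (Q j * P i)) + L (pderiv (P n) * P i)"
      by (simp add: distrib_right mlin_add sum_distrib_right mlin_sum)
    also have "(\<Sum>j=1..m. L (Q j * P i)) = (\<Sum>j=1..m. c j * poly (P n * P i) (t j))"
      using assms(2) \<open>i < n\<close> by (intro sum.cong) auto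
    \<comment> \<open>Of the product rule terms, the one with \<open>pderiv (P n)\<close> cancels
      the shift of the argument in \<open>?S\<close>, and the one with \<open>pderiv (P i)\<close>
      vanishes by degree.\<close>
    also have "\<dots> = 2 * L (mulx (P n * P i)) - L (pderiv (P n * P i))"
      by (rule sum_jump_poly)
    also have "L (pderiv (P n * P i)) = L (pderiv (P i) * P n) + L (pderiv (P n) * P i)"
      unfolding pderiv_mult mlin_add by (simp add: mult.commute)
    also have "L (pderiv (P i) * P n) = 0"
      by (rule orthp_orthogonal_lower) (use \<open>i < n\<close> in \<open>simp add: coeff_pderiv coeff_orthp_eq_0\<close>)
    finally show ?thesis unfolding T using orthp_orthogonal[OF \<open>i < n\<close>] by simp
  qed
qed

section \<open>Second derivatives of sigma\<close>

lemma rfun_derivatives: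
  assumes k: "k \<in> {1..m}"
  obtains d where "\<And>j. j \<in> {1..m} \<Longrightarrow>
      ((\<lambda>s. rfun m \<omega> n k (t(j := s))) has_real_derivative d j) (at (t j))"
    "(\<Sum>j=1..m. d j) = 2 * c k / h n *
        (h (Suc n) / h n * (poly (P n) (t k))\<^sup>2 - (poly (P (Suc n)) (t k))\<^sup>2)"
proof -
  let ?M = "\<lambda>j s. moment m \<omega> (t(j := s))"
  have "\<forall>n. \<forall>j\<in>{1..m}. \<exists>Q. has_coeff_deriv (\<lambda>s. orthp (?M j s) n) Q (t j) \<and>
      (\<forall>i\<ge>n. coeff Q i = 0) \<and> (\<forall>i<n. L (Q * P i) = c j * poly (P n * P i) (t j))"
    by (metis orthp_derivative)
  then obtain Q where Q: "\<And>n j. j \<in> {1..m} \<Longrightarrow> has_coeff_deriv (\<lambda>s. orthp (?M j s) n) (Q n j) (t j)"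
    "\<And>n j i. j \<in> {1..m} \<Longrightarrow> i \<ge> n \<Longrightarrow> coeff (Q n j) i = 0"
    "\<And>n j i. j \<in> {1..m} \<Longrightarrow> i < n \<Longrightarrow> L (Q n j * P i) = c j * poly (P n * P i) (t j)"
    by metis
  define a where "a = poly (P (Suc n)) (t k)"
  define b where "b = poly (P n) (t k)"
  define \<delta> where "\<delta> j = (if j = k then 1 else 0 :: real)" for j
  \<comment> \<open>The derivative of the value of \<open>P n\<close> at \<open>t k\<close> with
    respect to \<open>t j\<close>; for \<open>j = k\<close> the argument moves as well, whence
    \<open>\<delta>\<close>. Likewise \<open>E j\<close> is minus the derivative of
    \<open>h n\<close>.\<close>
  define A where "A n j = poly (Q n j) (t k) + poly (pderiv (P n)) (t k) * \<delta> j" for n j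
  define E where "E j = c j * (poly (P n) (t j))\<^sup>2" for j
  have s\<delta>: "(\<Sum>j=1..m. \<delta> j) = 1" using k by (simp add: \<delta>_def)
  have sumA: "(\<Sum>j=1..m. A n j) = 2 * (t k * poly (P n) (t k) - \<alpha> n * poly (P n) (t k) - poly (P (Suc n)) (t k))" for n
  proof -
    have "(\<Sum>j=1..m. A n j) = poly ((\<Sum>j=1..m. Q n j) + pderiv (P n)) (t k)"
      by (simp only: A_def sum.distrib sum_distrib_left[symmetric] s\<delta> poly_add poly_sum mult_1_right)
    also have "(\<Sum>j=1..m. Q n j) + pderiv (P n) = smult 2 (mulx (P n) - smult (\<alpha> n) (P n) - P (Suc n))"
      by (rule shift_orthp) (use Q in auto)
    finally show ?thesis by simp
  qed
  \<comment> \<open>At index \<open>Suc n\<close> the three-term recurrence collapses the ladder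
    relation to a multiple of \<open>P n\<close>.\<close>
  have "poly (mulx (P (Suc n)) - smult (\<alpha> (Suc n)) (P (Suc n)) - P (Suc (Suc n))) (t k)
      = poly (smult (h (Suc n) / h n) (P n)) (t k)"
    by (subst three_term) (rule refl)
  hence sumA1: "(\<Sum>j=1..m. A (Suc n) j) = 2 * (h (Suc n) / h n) * b"
    unfolding sumA by (simp add: b_def)
  have sumA0: "(\<Sum>j=1..m. A n j) = 2 * (t k * b - \<alpha> n * b - a)"
    unfolding sumA a_def b_def ..
  have sumE: "(\<Sum>j=1..m. E j) = 2 * \<alpha> n * h n"
    unfolding E_def by (rule sum_jump_sq)
  define d where "d j = ((- 2 * t k * c k * \<delta> j * (a * b) + c k * (A (Suc n) j * b + a * A n j)) * h n
      + c k * (a * b) * E j) / (h n * h n)" for j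
  have "((\<lambda>s. rfun m \<omega> n k (t(j := s))) has_real_derivative d j) (at (t j))" if j: "j \<in> {1..m}" for j
  proof -
    have x: "((\<lambda>s. (t(j := s)) k) has_real_derivative \<delta> j) (at (t j))"
      by (cases "j = k") (auto simp: \<delta>_def)
    have c: "((\<lambda>s. jump \<omega> (t(j := s)) k) has_real_derivative - 2 * t k * c k * \<delta> j) (at (t j))"
      unfolding jump_def by (rule derivative_eq_intros x refl)+ simp
    have p: "((\<lambda>s. poly (orthp (?M j s) n) ((t(j := s)) k)) has_real_derivative A n j) (at (t j))" for n
      using has_real_derivative_poly[OF Q(1)[OF j] x] by (simp add: A_def)
    have hd: "((\<lambda>s. onorm2 (?M j s) n) has_real_derivative - E j) (at (t j))"
      using onorm2_has_derivative[OF j] by (simp add: E_def)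
    have "((\<lambda>s. rfun m \<omega> n k (t(j := s))) has_real_derivative
       ((- 2 * t k * c k * \<delta> j * (a * b) + (A (Suc n) j * b + A n j * a) * c k) * h n
          - c k * (a * b) * (- E j)) / (h n * h n)) (at (t j))"
      using DERIV_divide[OF DERIV_mult[OF c DERIV_mult[OF p[of "Suc n"] p[of n]]] hd]
      by (simp add: rfun_def[abs_def] a_def b_def del: fun_upd_apply)
    thus ?thesis by (simp add: d_def mult_ac)
  qed
  moreover have "(\<Sum>j=1..m. d j) = 2 * c k / h n * (h (Suc n) / h n * b\<^sup>2 - a\<^sup>2)"
  proof -
    have "(\<Sum>j=1..m. d j) = ((- 2 * t k * c k * (a * b) * (\<Sum>j=1..m. \<delta> j)
      + c k * (b * (\<Sum>j=1..m. A (Suc n) j) + a * (\<Sum>j=1..m. A n j))) * h n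
      + c k * (a * b) * (\<Sum>j=1..m. E j)) / (h n * h n)"
      by (simp add: d_def sum.distrib sum_subtractf sum_distrib_left sum_distrib_right sum_divide_distrib[symmetric]
          algebra_simps)
    \<comment> \<open>The \<open>t k\<close> term from the Gaussian factor of the jump cancels the
      one in \<open>sumA0\<close>, and the \<open>\<alpha> n\<close> terms of \<open>sumA0\<close>
      and \<open>sumE\<close> cancel each other.\<close>
    also have "\<dots> = 2 * c k / h n * (h (Suc n) / h n * b\<^sup>2 - a\<^sup>2)"
      unfolding s\<delta> sumA1 sumA0 sumE by (simp add: field_simps power2_eq_square)
    finally show ?thesis .
  qed
  ultimately show thesis unfolding a_def b_def by (rule that)
qed

lemma partial_deriv_sigma_has_derivative:
  assumes "k \<in> {1..m}" "((\<lambda>s. rfun m \<omega> n k (t(j := s))) has_real_derivative d) (at (t j))"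
  shows "((\<lambda>s. partial_deriv k (sigma m \<omega> (Suc n)) (t(j := s))) has_real_derivative 2 * d) (at (t j))"
proof -
  have "eventually (\<lambda>s. partial_deriv k (sigma m \<omega> (Suc n)) (t(j := s)) = 2 * rfun m \<omega> n k (t(j := s))) (nhds (t j))"
    using eventually_jump_weight
    by (rule eventually_mono) (rule jump_weight.partial_deriv_sigma[OF _ assms(1)])
  moreover have "((\<lambda>s. 2 * rfun m \<omega> n k (t(j := s))) has_real_derivative 2 * d) (at (t j))"
    by (rule DERIV_cmult[OF assms(2)])
  ultimately show ?thesis by (subst DERIV_cong_ev[OF refl _ refl]) simp_all
qed

lemma sum_partial_deriv2_sigma:
  assumes k: "k \<in> {1..m}"
  shows "(\<Sum>j=1..m. partial_deriv j (partial_deriv k (sigma m \<omega> (Suc n))) t) = 4 * c k / h n *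
        (h (Suc n) / h n * (poly (P n) (t k))\<^sup>2 - (poly (P (Suc n)) (t k))\<^sup>2)"
proof -
  obtain d where d: "\<And>j. j \<in> {1..m} \<Longrightarrow>
      ((\<lambda>s. rfun m \<omega> n k (t(j := s))) has_real_derivative d j) (at (t j))"
    "(\<Sum>j=1..m. d j) = 2 * c k / h n *
        (h (Suc n) / h n * (poly (P n) (t k))\<^sup>2 - (poly (P (Suc n)) (t k))\<^sup>2)"
    using rfun_derivatives[OF k] by blast
  have "(\<Sum>j=1..m. partial_deriv j (partial_deriv k (sigma m \<omega> (Suc n))) t) = (\<Sum>j=1..m. 2 * d j)"
    unfolding partial_deriv_def[of _ "partial_deriv k _"]
    by (intro sum.cong refl DERIV_imp_deriv partial_deriv_sigma_has_derivative[OF k] d(1))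
  thus ?thesis using d(2) by (simp add: sum_distrib_left[symmetric])
qed

text \<open>The term \<open>real (Suc n)\<close> produced by integration by parts is exactly
  compensated by the added constant.\<close>

lemma sum_partial_deriv_sigma:
  "(\<Sum>k=1..m. partial_deriv k (sigma m \<omega> (Suc n)) t) + 2 * real (Suc n) = 4 * (h (Suc n) / h n)"
proof -
  have "(\<Sum>k=1..m. partial_deriv k (sigma m \<omega> (Suc n)) t) = (\<Sum>k=1..m. 2 * rfun m \<omega> n k t)"
    by (intro sum.cong refl partial_deriv_sigma)
  also have "\<dots> = 2 / h n * (\<Sum>k=1..m. c k * (poly (P (Suc n)) (t k) * poly (P n) (t k)))"
    by (simp add: rfun_def sum_distrib_left)
  also have "\<dots> = 2 / h n * (2 * h (Suc n) - real (Suc n) * h n)"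
    by (simp only: sum_jump_consecutive)
  finally show ?thesis by (simp add: field_simps)
qed

text \<open>The extra factor \<open>t k\<close> produces the subleading coefficient besides the
  recurrence coefficients; subtracting \<open>sigma\<close> removes it.\<close>

lemma sum_t_partial_deriv_sigma:
  "(\<Sum>k=1..m. t k * partial_deriv k (sigma m \<omega> (Suc n)) t) - sigma m \<omega> (Suc n) t
     = 4 * (h (Suc n) / h n) * (\<alpha> (Suc n) + \<alpha> n)"
proof -
  have "(\<Sum>k=1..m. t k * partial_deriv k (sigma m \<omega> (Suc n)) t) = (\<Sum>k=1..m. t k * (2 * rfun m \<omega> n k t))"
    by (intro sum.cong refl arg_cong2[of _ _ _ _ "(*)"] partial_deriv_sigma)
  also have "\<dots> = 2 / h n * (\<Sum>k=1..m. c k * (t k * (poly (P (Suc n)) (t k) * poly (P n) (t k))))"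
    by (simp add: rfun_def sum_distrib_left mult_ac)
  finally show ?thesis
    unfolding sum_jump_consecutive_mulx sigma_eq by (simp add: field_simps)
qed

section \<open>The partial differential equation\<close>

lemma sgn_sqrt_discriminant:
  "sgn (\<omega> k) * sqrt ((4 * c k / H * (\<beta> * b\<^sup>2 - a\<^sup>2))\<^sup>2 + 4 * (4 * \<beta>) * (2 * (c k * (a * b) / H))\<^sup>2)
     = 4 * c k / H * (\<beta> * b\<^sup>2 + a\<^sup>2)" if "\<beta> > 0" "H > 0"
proof -
  \<comment> \<open>Completing the square: the second summand is four times the product of
    \<open>\<beta> * b\<^sup>2\<close> and \<open>a\<^sup>2\<close>, up to the common factor, so the
    minus sign becomes a plus.\<close>
  have "(4 * c k / H * (\<beta> * b\<^sup>2 - a\<^sup>2))\<^sup>2 + 4 * (4 * \<beta>) * (2 * (c k * (a * b) / H))\<^sup>2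
      = (4 * c k / H * (\<beta> * b\<^sup>2 + a\<^sup>2))\<^sup>2"
    using that by (simp add: field_simps power2_eq_square)
  hence "sqrt ((4 * c k / H * (\<beta> * b\<^sup>2 - a\<^sup>2))\<^sup>2 + 4 * (4 * \<beta>) * (2 * (c k * (a * b) / H))\<^sup>2)
      = \<bar>c k\<bar> * (4 / H * (\<beta> * b\<^sup>2 + a\<^sup>2))"
    using that by (simp add: abs_mult)
  \<comment> \<open>\<open>c k\<close> is \<open>\<omega> k\<close> times a positive exponential;
    the sign undoes the absolute value left by the root.\<close>
  moreover have "sgn (\<omega> k) * \<bar>c k\<bar> = c k"
    by (simp add: jump_def abs_mult sgn_mult_abs mult.assoc[symmetric] mult.commute[of "sgn (\<omega> k)"])
  ultimately show ?thesis by (simp add: mult.assoc[symmetric])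
qed

text \<open>Once the roots are extracted, the summands are linear in \<open>c k\<close> times the
  squares of \<open>P n\<close> and \<open>P (Suc n)\<close> at \<open>t k\<close>, so
  \<open>sum_jump_sq\<close> evaluates the sum.\<close>

lemma sigma_pde:
  "(\<Sum>k=1..m. sgn (\<omega> k) * sqrt (
        (partial_deriv k (partial_deriv k (sigma m \<omega> (Suc n))) t
          + (\<Sum>j\<in>{1..m} - {k}. partial_deriv j (partial_deriv k (sigma m \<omega> (Suc n))) t))^2
        + 4 * ((\<Sum>j=1..m. partial_deriv j (sigma m \<omega> (Suc n)) t) + 2 * real (Suc n))
            * (partial_deriv k (sigma m \<omega> (Suc n)) t)^2))
    = 2 * ((\<Sum>k=1..m. t k * partial_deriv k (sigma m \<omega> (Suc n)) t) - sigma m \<omega> (Suc n) t)"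
    (is "(\<Sum>k=1..m. ?T k) = _")
proof -
  let ?\<beta> = "h (Suc n) / h n"
  have "?T k = 4 * c k / h n * (?\<beta> * (poly (P n) (t k))\<^sup>2 + (poly (P (Suc n)) (t k))\<^sup>2)"
    if k: "k \<in> {1..m}" for k
  proof -
    have "partial_deriv k (partial_deriv k (sigma m \<omega> (Suc n))) t
          + (\<Sum>j\<in>{1..m} - {k}. partial_deriv j (partial_deriv k (sigma m \<omega> (Suc n))) t)
        = (\<Sum>j=1..m. partial_deriv j (partial_deriv k (sigma m \<omega> (Suc n))) t)"
      using k by (subst sum.remove[of _ k]) auto
    thus ?thesis
      unfolding sum_partial_deriv_sigma sum_partial_deriv2_sigma[OF k] partial_deriv_sigma[OF k] rfun_def
      by (simp only:) (rule sgn_sqrt_discriminant, auto simp: onorm2_pos)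
  qed
  hence "(\<Sum>k=1..m. ?T k)
      = (\<Sum>k=1..m. 4 * c k / h n * (?\<beta> * (poly (P n) (t k))\<^sup>2 + (poly (P (Suc n)) (t k))\<^sup>2))"
    by (intro sum.cong) auto
  also have "\<dots> = 4 / h n * (?\<beta> * (\<Sum>k=1..m. c k * (poly (P n) (t k))\<^sup>2)
      + (\<Sum>k=1..m. c k * (poly (P (Suc n)) (t k))\<^sup>2))"
    by (simp add: sum_distrib_left sum.distrib algebra_simps)
  also have "\<dots> = 2 * (4 * ?\<beta> * (\<alpha> (Suc n) + \<alpha> n))"
    unfolding sum_jump_sq by (simp add: field_simps)
  finally show ?thesis unfolding sum_t_partial_deriv_sigma .
qed

end

text \<open>\<open>deriv\<close> yields a value for every function, so the differentiability clauses
  record that the first and second derivatives of \<open>sigma\<close> in the equation really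
  exist.\<close>

theorem theorem4p2:
  fixes m n :: nat and \<omega> t :: "nat \<Rightarrow> real"
  assumes "m \<ge> 1" and "n \<ge> 1"
    and "\<forall>k. 1 \<le> k \<and> k < m \<longrightarrow> t k < t (Suc k)"
    and "\<forall>l\<le>m. (\<Sum>k=0..l. \<omega> k) \<ge> 0"
    and "\<exists>x. wgt m \<omega> t x \<noteq> 0"
  shows "(\<forall>k\<in>{1..m}. (\<lambda>s. sigma m \<omega> n (t(k := s))) differentiable (at (t k)))
    \<and> (\<forall>k\<in>{1..m}. \<forall>j\<in>{1..m}.
         (\<lambda>s. partial_deriv k (sigma m \<omega> n) (t(j := s))) differentiable (at (t j)))
    \<and> (\<Sum>k=1..m. sgn (\<omega> k) * sqrt (
          (partial_deriv k (partial_deriv k (sigma m \<omega> n)) t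
            + (\<Sum>j\<in>{1..m} - {k}. partial_deriv j (partial_deriv k (sigma m \<omega> n)) t))^2
          + 4 * ((\<Sum>j=1..m. partial_deriv j (sigma m \<omega> n) t) + 2 * real n)
              * (partial_deriv k (sigma m \<omega> n) t)^2))
      = 2 * ((\<Sum>k=1..m. t k * partial_deriv k (sigma m \<omega> n) t) - sigma m \<omega> n t)"
proof -
  have ord: "ordered_upto m t" using assms(3) by (simp add: ordered_upto_def)
  interpret jump_weight m \<omega> t
    by standard (use ord valid_jumpsI[OF ord assms(4,5)] in auto)
  \<comment> \<open>The locale results are indexed by the predecessor of \<open>n\<close>.\<close>
  obtain N where n: "n = Suc N" using assms(2) by (cases n) auto
  have "(\<lambda>s. sigma m \<omega> n (t(k := s))) differentiable (at (t k))" if "k \<in> {1..m}" for k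
    unfolding n real_differentiable_def by (rule exI) (rule sigma_has_derivative[OF that])
  moreover have "(\<lambda>s. partial_deriv k (sigma m \<omega> n) (t(j := s))) differentiable (at (t j))"
    if k: "k \<in> {1..m}" and j: "j \<in> {1..m}" for k j
  proof -
    obtain d where "((\<lambda>s. rfun m \<omega> N k (t(j := s))) has_real_derivative d) (at (t j))"
      using rfun_derivatives[OF k] j by blast
    from partial_deriv_sigma_has_derivative[OF k this] show ?thesis
      unfolding n real_differentiable_def by (rule exI)
  qed
  ultimately show ?thesis using sigma_pde[of N] unfolding n by blast
qed

end
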